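(* Let $n$ be any given integer. Then there exist a real analytic Liouville metric $g=Q(x)\,(dx^2+dy^2)$ on $\mathbb{T}^2=(\mathbb{R}/2\pi\mathbb{Z})^2$ and an eigenfunction $\Phi$ of the associated Laplace-Beltrami operator, $-\Delta_g\Phi=\Phi$, with eigenvalue $1$, such that the super-level set $\{\Phi>1\}$ has at least $n$ connected components. One can choose the metric $g$ arbitrarily close to the flat metric $g_0=dx^2+dy^2$. Taking $n\ge4$, and $g$ close enough to $g_0$, the eigenvalue $1$ is either the second, third or fourth eigenvalue of $-\Delta_g$.
   Context: $(x,y)$ are the standard coordinates on $\mathbb{T}^2$. A Liouville metric here is a metric $Q(x)(dx^2+dy^2)$ with $Q$ a positive function on $\mathbb{R}/2\pi\mathbb{Z}$ (here real analytic); its Laplace-Beltrami operator is $\Delta_g=Q(x)^{-1}(\partial_x^2+\partial_y^2)$. The eigenvalues of $-\Delta_g$ are listed in nondecreasing order with multiplicities, starting from label $1$: $0=\lambda_1<\lambda_2\le\lambda_3\le\cdots$. "The eigenvalue $1$ is the $k$-th eigenvalue" means that $k$ is the least index with $\lambda_k=1$. Closeness of $g$ to $g_0$ means closeness of $Q$ to the constant function $1$ in the $C^\infty$ topology. The metric referred to in the last two sentences of the claim is one for which, together with a suitable $\Phi$, the first assertion holds: that is, metrics $g$ with the stated properties can be found arbitrarily close to $g_0$, and for $n\ge4$ they can be so chosen with the eigenvalue $1$ being the second, third or fourth. *)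

theory Defs
  imports "HOL-Analysis.Analysis" "HOL-Library.Function_Algebras"
begin

section \<open>Liouville metrics on the torus\<close>

definition real_analytic :: "(real \<Rightarrow> real) \<Rightarrow> bool" where
  "real_analytic f \<longleftrightarrow> (\<forall>x0. \<exists>F. (\<lambda>t. f (x0 + t)) has_fps_expansion F)"

text \<open>A real analytic Liouville metric \<open>Q(x) (dx\<^sup>2 + dy\<^sup>2)\<close> is represented by its conformal factor
  \<open>Q\<close>, a function on \<open>\<real>/2\<pi>\<int>\<close>, i.e. a \<open>2\<pi>\<close>-periodic function on \<open>\<real>\<close>.\<close>

definition liouville_metric :: "(real \<Rightarrow> real) \<Rightarrow> bool" where
  "liouville_metric Q \<longleftrightarrow>
     real_analytic Q \<and> (\<forall>x. Q x > 0) \<and> (\<forall>x. Q (x + 2 * pi) = Q x)"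

text \<open>The sets \<open>{Q. Cinf_close N \<epsilon> Q R}\<close> with \<open>\<epsilon> > 0\<close> form a neighbourhood basis of \<open>R\<close> in the
  \<open>C\<^sup>\<infinity>\<close> topology on the smooth functions on \<open>\<real>/2\<pi>\<int>\<close>.\<close>

definition Cinf_close :: "nat \<Rightarrow> real \<Rightarrow> (real \<Rightarrow> real) \<Rightarrow> (real \<Rightarrow> real) \<Rightarrow> bool" where
  "Cinf_close N \<epsilon> Q R \<longleftrightarrow>
     (\<forall>j\<le>N. \<forall>x. \<bar>(deriv ^^ j) Q x - (deriv ^^ j) R x\<bar> < \<epsilon>)"

section \<open>Functions on the torus and the Laplace--Beltrami operator\<close>

text \<open>Functions on \<open>(\<real>/2\<pi>\<int>)\<^sup>2\<close> are functions on \<open>\<real>\<^sup>2\<close> that are \<open>2\<pi>\<close>-periodic in both coordinates.\<close>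

definition partial_x :: "(real \<times> real \<Rightarrow> real) \<Rightarrow> real \<times> real \<Rightarrow> real" where
  "partial_x f = (\<lambda>(x, y). deriv (\<lambda>s. f (s, y)) x)"

definition partial_y :: "(real \<times> real \<Rightarrow> real) \<Rightarrow> real \<times> real \<Rightarrow> real" where
  "partial_y f = (\<lambda>(x, y). deriv (\<lambda>t. f (x, t)) y)"

primrec C_k :: "nat \<Rightarrow> (real \<times> real \<Rightarrow> real) \<Rightarrow> bool" where
  "C_k 0 f \<longleftrightarrow> continuous_on UNIV f"
| "C_k (Suc k) f \<longleftrightarrow>
     (\<forall>x y. (\<lambda>s. f (s, y)) differentiable (at x) \<and> (\<lambda>t. f (x, t)) differentiable (at y)) \<and>
     C_k k (partial_x f) \<and> C_k k (partial_y f)"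

definition smooth_on_torus :: "(real \<times> real \<Rightarrow> real) \<Rightarrow> bool" where
  "smooth_on_torus f \<longleftrightarrow> (\<forall>k. C_k k f) \<and>
     (\<forall>x y. f (x + 2 * pi, y) = f (x, y) \<and> f (x, y + 2 * pi) = f (x, y))"

definition laplace_beltrami ::
    "(real \<Rightarrow> real) \<Rightarrow> (real \<times> real \<Rightarrow> real) \<Rightarrow> real \<times> real \<Rightarrow> real" where
  "laplace_beltrami Q f = (\<lambda>(x, y).
     (partial_x (partial_x f) (x, y) + partial_y (partial_y f) (x, y)) / Q x)"

definition eigenspace :: "(real \<Rightarrow> real) \<Rightarrow> real \<Rightarrow> (real \<times> real \<Rightarrow> real) set" where
  "eigenspace Q \<mu> = {f. smooth_on_torus f \<and> (\<forall>p. - laplace_beltrami Q f p = \<mu> * f p)}"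

definition eigenfunction :: "(real \<Rightarrow> real) \<Rightarrow> real \<Rightarrow> (real \<times> real \<Rightarrow> real) \<Rightarrow> bool" where
  "eigenfunction Q \<mu> f \<longleftrightarrow> f \<in> eigenspace Q \<mu> \<and> (\<exists>p. f p \<noteq> 0)"

section \<open>Labelling of the eigenvalues\<close>

interpretation fun_space: vector_space "\<lambda>(c::real) (f::real \<times> real \<Rightarrow> real) p. c * f p"
  by unfold_locales (simp_all add: fun_eq_iff algebra_simps)

definition eigenvalue_mult :: "(real \<Rightarrow> real) \<Rightarrow> real \<Rightarrow> nat" where
  "eigenvalue_mult Q \<mu> = fun_space.dim (eigenspace Q \<mu>)"

definition eigenvalue_count :: "(real \<Rightarrow> real) \<Rightarrow> real \<Rightarrow> nat" where
  "eigenvalue_count Q \<mu> = (\<Sum>\<nu> | \<nu> \<le> \<mu> \<and> eigenvalue_mult Q \<nu> > 0. eigenvalue_mult Q \<nu>)"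

text \<open>The term \<open>\<lambda>\<^sub>k\<close> (for \<open>k \<ge> 1\<close>) of the list of the eigenvalues in nondecreasing order and with
  multiplicities; the lemma \<open>liouville_eigenvalue_listing\<close> below relates it to that list.\<close>

definition liouville_eigenvalue :: "(real \<Rightarrow> real) \<Rightarrow> nat \<Rightarrow> real" where
  "liouville_eigenvalue Q k = (LEAST \<mu>. k \<le> eigenvalue_count Q \<mu>)"

definition is_kth_eigenvalue :: "(real \<Rightarrow> real) \<Rightarrow> nat \<Rightarrow> real \<Rightarrow> bool" where
  "is_kth_eigenvalue Q k \<mu> \<longleftrightarrow> k \<ge> 1 \<and> liouville_eigenvalue Q k = \<mu> \<and>
     (\<forall>j. 1 \<le> j \<and> j < k \<longrightarrow> liouville_eigenvalue Q j \<noteq> \<mu>)"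

lemma liouville_eigenvalue_listing:
  fixes lam :: "nat \<Rightarrow> real"
  assumes mono: "\<And>i j. 1 \<le> i \<Longrightarrow> i \<le> j \<Longrightarrow> lam i \<le> lam j"
    and lim: "filterlim lam at_top sequentially"
    and mult: "\<And>\<mu>. card {i. 1 \<le> i \<and> lam i = \<mu>} = eigenvalue_mult Q \<mu>"
    and k: "1 \<le> k"
  shows "liouville_eigenvalue Q k = lam k"
proof -
  have fin: "finite {i. 1 \<le> i \<and> lam i \<le> \<mu>}" for \<mu>
  proof -
    obtain M where M: "\<And>i. i \<ge> M \<Longrightarrow> lam i > \<mu>"
      using lim unfolding filterlim_at_top_dense eventually_sequentially by blast
    have "{i. 1 \<le> i \<and> lam i \<le> \<mu>} \<subseteq> {..<M}"
      using M by (auto simp: not_le[symmetric])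
    then show ?thesis using finite_subset by blast
  qed
  have cnt: "eigenvalue_count Q \<mu> = card {i. 1 \<le> i \<and> lam i \<le> \<mu>}" for \<mu>
  proof -
    let ?I = "{i. 1 \<le> i \<and> lam i \<le> \<mu>}"
    have pos: "(eigenvalue_mult Q \<nu> > 0) \<longleftrightarrow> (\<exists>i\<ge>1. lam i = \<nu>)" if "\<nu> \<le> \<mu>" for \<nu>
    proof -
      have "finite {i. 1 \<le> i \<and> lam i = \<nu>}"
        by (rule finite_subset[OF _ fin[of \<nu>]]) auto
      then show ?thesis unfolding mult[symmetric] card_gt_0_iff by blast
    qed
    have img: "{\<nu>. \<nu> \<le> \<mu> \<and> eigenvalue_mult Q \<nu> > 0} = lam ` ?I"
    proof (intro set_eqI iffI)
      fix \<nu> assume "\<nu> \<in> {\<nu>. \<nu> \<le> \<mu> \<and> eigenvalue_mult Q \<nu> > 0}"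
      then have "\<nu> \<le> \<mu>" "\<exists>i\<ge>1. lam i = \<nu>" using pos by blast+
      then show "\<nu> \<in> lam ` ?I" by blast
    next
      fix \<nu> assume "\<nu> \<in> lam ` ?I"
      then have "\<nu> \<le> \<mu>" "\<exists>i\<ge>1. lam i = \<nu>" by blast+
      then show "\<nu> \<in> {\<nu>. \<nu> \<le> \<mu> \<and> eigenvalue_mult Q \<nu> > 0}" using pos by blast
    qed
    have "card ?I = (\<Sum>\<nu>\<in>lam ` ?I. card {i \<in> ?I. lam i = \<nu>})"
      using sum.image_gen[OF fin, of "\<lambda>_. 1::nat" \<mu> lam] by simp
    also have "\<dots> = (\<Sum>\<nu>\<in>lam ` ?I. eigenvalue_mult Q \<nu>)"
      by (rule sum.cong[OF refl], subst mult[symmetric], rule arg_cong[where f = card]) auto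
    finally show ?thesis unfolding eigenvalue_count_def img by simp
  qed
  have iff: "k \<le> eigenvalue_count Q \<mu> \<longleftrightarrow> lam k \<le> \<mu>" for \<mu>
  proof
    assume "lam k \<le> \<mu>"
    then have "{1..k} \<subseteq> {i. 1 \<le> i \<and> lam i \<le> \<mu>}"
      using mono order_trans by fastforce
    then have "card {1..k} \<le> card {i. 1 \<le> i \<and> lam i \<le> \<mu>}"
      by (rule card_mono[OF fin])
    then show "k \<le> eigenvalue_count Q \<mu>"
      unfolding cnt by simp
  next
    assume le: "k \<le> eigenvalue_count Q \<mu>"
    show "lam k \<le> \<mu>"
    proof (rule ccontr)
      assume "\<not> lam k \<le> \<mu>"
      then have "i < k" if "1 \<le> i" "lam i \<le> \<mu>" for i
        using mono[of k i] k that by (meson not_le order_trans)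
      then have "{i. 1 \<le> i \<and> lam i \<le> \<mu>} \<subseteq> {1..<k}"
        by auto
      then have "card {i. 1 \<le> i \<and> lam i \<le> \<mu>} \<le> card {1..<k}"
        by (intro card_mono) auto
      then have "eigenvalue_count Q \<mu> \<le> k - 1"
        unfolding cnt by simp
      then show False using le k by simp
    qed
  qed
  show ?thesis
    unfolding liouville_eigenvalue_def iff by (rule Least_equality) auto
qed

section \<open>Super-level sets\<close>

text \<open>\<open>torus_proj\<close> induces a homeomorphism from the quotient \<open>(\<real>/2\<pi>\<int>)\<^sup>2\<close> onto the product of two unit
  circles. The components of a super-level set are taken in the torus, not in its cover \<open>\<real>\<^sup>2\<close>.\<close>

definition torus_proj :: "real \<times> real \<Rightarrow> complex \<times> complex" where
  "torus_proj = (\<lambda>(x, y). (cis x, cis y))"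

definition superlevel_components ::
    "(real \<times> real \<Rightarrow> real) \<Rightarrow> real \<Rightarrow> (complex \<times> complex) set set" where
  "superlevel_components f c = components (torus_proj ` {p. f p > c})"

end

theory Submission
  imports Defs
begin

text \<open>For every smooth positive function \<open>F\<close> on the circle, \<open>\<Phi> = F(x) cos y\<close> satisfies \<open>- \<Delta> \<Phi> = Q \<Phi>\<close> for the flat
  Laplacian and \<open>Q = 1 - F'' / F\<close>; hence it is an eigenfunction with eigenvalue \<open>1\<close> of the Liouville
  metric \<open>Q (dx\<^sup>2 + dy\<^sup>2)\<close>, once \<open>Q\<close> is positive. The choice \<open>F = exp (\<epsilon> cos (\<kappa> x))\<close> with an
  integer \<open>\<kappa> \<ge> n\<close> and a small \<open>\<epsilon> > 0\<close> makes \<open>Q\<close> a trigonometric polynomial that tends to \<open>1\<close> with all its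
  derivatives as \<open>\<epsilon>\<close> tends to \<open>0\<close>. Since \<open>\<Phi> > 1\<close> implies \<open>F > 1\<close>, the super-level set
  avoids the circles where \<open>cos (\<kappa> x) \<le> 0\<close>, and it contains the \<open>\<kappa>\<close> points where \<open>cos (\<kappa> x) = 1\<close>
  and \<open>y = 0\<close>: each of them lies in a component of its own (\<open>superlevel_components_product\<close>).

  The position of the eigenvalue \<open>1\<close> needs an upper bound for the number of eigenvalues \<open>\<le> 1\<close>. For an
  eigenfunction \<open>f\<close> with eigenvalue \<open>\<nu> \<le> 1\<close>, subtract its mean \<open>a(x)\<close> over the fibres
  \<open>x = const\<close>. The rest is compared with \<open>F\<close>: Wirtinger's inequality on the fibres makes a certain
  periodic function of \<open>x\<close> monotone, hence constant (\<open>mean_zero_fibres_proportional\<close>), and therefore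
  \<open>f = a(x) + F(x) (b cos y + c sin y)\<close>, where \<open>b = c = 0\<close> unless \<open>\<nu> = 1\<close>
  (\<open>eigenspace_structure\<close>). The functions \<open>a\<close> solve \<open>a'' = - \<nu> Q a\<close>, and a
  combination of them that vanishes at three equidistant points is zero, by a Dirichlet inequality on
  the three arcs (\<open>sturm_three_zeros\<close>). So three values of \<open>a\<close> together with \<open>b\<close> and \<open>c\<close> determine everything:
  the eigenspaces with \<open>\<nu> \<le> 1\<close> embed as a direct sum into \<open>\<real>\<^sup>5\<close>, and at most five eigenvalues are
  \<open>\<le> 1\<close>. The constants account for one below \<open>1\<close>; \<open>F cos y\<close> and \<open>F sin y\<close> for two that equal \<open>1\<close>.
  Hence the first label of the eigenvalue \<open>1\<close> is \<open>2\<close>, \<open>3\<close> or \<open>4\<close> (\<open>index_of_eigenvalue_1\<close>).\<close>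

section \<open>Poincare inequalities on the line and the circle\<close>

text \<open>A Riccati substitution: if \<open>w' = - l\<^sup>2 - w\<^sup>2\<close>, then
  \<open>(v')\<^sup>2 - l\<^sup>2 v\<^sup>2 = (v' - w v)\<^sup>2 + (w v\<^sup>2)'\<close>, and the last term integrates to \<open>0\<close>
  because \<open>v\<close> vanishes at both ends. The cotangent of a phase that advances with speed \<open>l\<close> solves the
  Riccati equation; on an interval shorter than \<open>\<pi> / l\<close> the phase can be centred so as to
  stay inside \<open>(0, \<pi>)\<close>, and then \<open>w\<close> has no singularity.\<close>

lemma dirichlet_poincare:
  fixes v v' :: "real \<Rightarrow> real"
  assumes deriv: "\<And>t. (v has_field_derivative v' t) (at t)"
    and cont: "continuous_on UNIV v'"
    and ends: "v a = 0" "v b = 0"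
    and len: "a \<le> b" "0 < l" "l * (b - a) < pi"
  shows "l\<^sup>2 * integral {a..b} (\<lambda>t. (v t)\<^sup>2) \<le> integral {a..b} (\<lambda>t. (v' t)\<^sup>2)"
proof -
  \<comment> \<open>The phase keeps at least the distance \<open>(\<pi> - l (b - a)) / 2\<close> from both \<open>0\<close> and \<open>\<pi>\<close>.\<close>
  define \<theta> where "\<theta> t = l * (t - a) + (pi - l * (b - a)) / 2" for t
  define w where "w t = l * cot (\<theta> t)" for t
  have sin_pos: "sin (\<theta> t) > 0" if "t \<in> {a..b}" for t
  proof (rule sin_gt_zero)
    have "l * (t - a) \<ge> 0" "l * (t - a) \<le> l * (b - a)" using that len by auto
    then show "0 < \<theta> t" "\<theta> t < pi" using len unfolding \<theta>_def by argo+
  qed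
  have contv: "continuous_on S v" for S
    using deriv DERIV_isCont continuous_at_imp_continuous_on by blast
  have contv': "continuous_on S v'" for S
    using cont continuous_on_subset by blast
  have cw: "continuous_on {a..b} w"
    unfolding w_def \<theta>_def
    by (intro continuous_intros) (use sin_pos in \<open>force simp: \<theta>_def\<close>)
  have G: "((\<lambda>t. w t * (v t)\<^sup>2) has_real_derivative
      ((v' t)\<^sup>2 - l\<^sup>2 * (v t)\<^sup>2 - (v' t - w t * v t)\<^sup>2)) (at t within {a..b})"
    if t: "t \<in> {a..b}" for t
  proof -
    have "(w has_real_derivative - l\<^sup>2 - (w t)\<^sup>2) (at t)"
    proof -
      have "(\<theta> has_real_derivative l) (at t)"
        unfolding \<theta>_def by (auto intro!: derivative_eq_intros)
      then have "((\<lambda>t. cot (\<theta> t)) has_real_derivative - inverse ((sin (\<theta> t))\<^sup>2) * l) (at t)"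
        using DERIV_chain2[OF DERIV_cot] sin_pos[OF t] by (metis less_irrefl)
      then have "(w has_real_derivative l * (- inverse ((sin (\<theta> t))\<^sup>2) * l)) (at t)"
        unfolding w_def by (rule DERIV_cmult)
      moreover have "inverse ((sin (\<theta> t))\<^sup>2) = 1 + (cot (\<theta> t))\<^sup>2"
        using sin_pos[OF t] sin_cos_squared_add[of "\<theta> t"]
        by (simp add: cot_def power_divide field_simps)
      ultimately show ?thesis by (simp add: w_def algebra_simps power2_eq_square)
    qed
    then have "((\<lambda>t. w t * (v t)\<^sup>2) has_real_derivative
        (- l\<^sup>2 - (w t)\<^sup>2) * (v t)\<^sup>2 + w t * (2 * v t * v' t)) (at t)"
      by (auto intro!: derivative_eq_intros deriv[of t])
    moreover have "(- l\<^sup>2 - (w t)\<^sup>2) * (v t)\<^sup>2 + w t * (2 * v t * v' t)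
        = (v' t)\<^sup>2 - l\<^sup>2 * (v t)\<^sup>2 - (v' t - w t * v t)\<^sup>2" by algebra
    ultimately show ?thesis using DERIV_subset by fastforce
  qed
  have "((\<lambda>t. (v' t)\<^sup>2 - l\<^sup>2 * (v t)\<^sup>2 - (v' t - w t * v t)\<^sup>2) has_integral
      w b * (v b)\<^sup>2 - w a * (v a)\<^sup>2) {a..b}"
    by (rule fundamental_theorem_of_calculus[OF len(1)])
      (use G in \<open>simp add: has_real_derivative_iff_has_vector_derivative\<close>)
  then have I0: "integral {a..b} (\<lambda>t. (v' t)\<^sup>2 - l\<^sup>2 * (v t)\<^sup>2 - (v' t - w t * v t)\<^sup>2) = 0"
    using ends by (simp add: integral_unique)
  have "integral {a..b} (\<lambda>t. (v' t)\<^sup>2 - l\<^sup>2 * (v t)\<^sup>2 - (v' t - w t * v t)\<^sup>2)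
    = integral {a..b} (\<lambda>t. (v' t)\<^sup>2) - l\<^sup>2 * integral {a..b} (\<lambda>t. (v t)\<^sup>2)
      - integral {a..b} (\<lambda>t. (v' t - w t * v t)\<^sup>2)"
    by (subst integral_diff integral_mult_right;
        (intro integrable_continuous_real continuous_intros contv contv' cw)?)+ simp
  moreover have "integral {a..b} (\<lambda>t. (v' t - w t * v t)\<^sup>2) \<ge> 0"
    by (rule integral_nonneg)
       (intro integrable_continuous_real continuous_intros contv contv' cw, auto)
  ultimately show ?thesis using I0 by linarith
qed

text \<open>The borderline length, where the phase above would have to run from \<open>0\<close> to \<open>\<pi>\<close>, follows by
  letting \<open>l\<close> tend to \<open>1\<close> from below.\<close>

lemma dirichlet_poincare_pi:
  fixes v v' :: "real \<Rightarrow> real"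
  assumes deriv: "\<And>t. (v has_field_derivative v' t) (at t)"
    and cont: "continuous_on UNIV v'"
    and ends: "v a = 0" "v (a + pi) = 0"
  shows "integral {a..a + pi} (\<lambda>t. (v t)\<^sup>2) \<le> integral {a..a + pi} (\<lambda>t. (v' t)\<^sup>2)"
proof (rule tendsto_upperbound)
  show "((\<lambda>l. l\<^sup>2 * integral {a..a + pi} (\<lambda>t. (v t)\<^sup>2)) \<longlongrightarrow> integral {a..a + pi} (\<lambda>t. (v t)\<^sup>2)) (at_left 1)"
    by (auto intro!: tendsto_eq_intros)
  have "eventually (\<lambda>l. l \<in> {0<..<1::real}) (at_left 1)"
    by (rule eventually_at_leftI[of 0]) auto
  then show "\<forall>\<^sub>F l in at_left 1. l\<^sup>2 * integral {a..a + pi} (\<lambda>t. (v t)\<^sup>2)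
      \<le> integral {a..a + pi} (\<lambda>t. (v' t)\<^sup>2)"
    by eventually_elim (intro dirichlet_poincare[OF deriv cont ends]; simp)
qed simp

lemma deriv_periodic:
  fixes k k' :: "real \<Rightarrow> real"
  assumes deriv: "\<And>t. (k has_field_derivative k' t) (at t)" and per: "\<And>t. k (t + p) = k t"
  shows "k' (t + p) = k' t"
proof -
  have "((\<lambda>s. k (s + p)) has_field_derivative k' (t + p)) (at t)"
    using deriv[of "t + p"] by (simp add: DERIV_shift)
  then have "(k has_field_derivative k' (t + p)) (at t)"
    by (simp only: per)
  then show ?thesis using deriv by (rule DERIV_unique)
qed

lemma integral_period_shift:
  fixes g :: "real \<Rightarrow> real"
  assumes cont: "continuous_on UNIV g" and per: "\<And>t. g (t + p) = g t" and "0 \<le> p"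
  shows "integral {a..a + p} g = integral {0..p} g"
proof -
  have int: "g integrable_on {s..t}" for s t
    using cont by (intro integrable_continuous_real) (rule continuous_on_subset, auto)
  have shift: "integral {s + p..t + p} g = integral {s..t} g" for s t
  proof -
    have "g \<circ> (+) p = g" using per by (auto simp: add.commute)
    then show ?thesis using integral_shift_Icc_real[of s t g p] by simp
  qed
  have mid: "integral {s..s + p} g = integral {t..t + p} g" if "s \<le> t" "t \<le> s + p" for s t
  proof -
    have "integral {s..s + p} g = integral {s..t} g + integral {t..s + p} g"
      using that int by (intro Henstock_Kurzweil_Integration.integral_combine[symmetric]) auto
    also have "integral {s..t} g = integral {s + p..t + p} g" by (simp add: shift)
    also have "integral {s + p..t + p} g + integral {t..s + p} g = integral {t..t + p} g"
      using that int by (subst add.commute, intro Henstock_Kurzweil_Integration.integral_combine) auto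
    finally show ?thesis .
  qed
  show ?thesis
  proof (cases "p = 0")
    case False
    then have "p > 0" using assms by simp
    define m where "m = floor (a / p)"
    have m: "of_int m * p \<le> a" "a \<le> of_int m * p + p"
      using floor_divide_lower[OF \<open>p > 0\<close>, of a] floor_divide_upper[OF \<open>p > 0\<close>, of a]
      by (simp_all add: m_def distrib_right)
    have "integral {of_int j * p..of_int j * p + p} g = integral {0..p} g" for j
    proof (induction j rule: int_induct[of _ 0])
      case (step1 i)
      then show ?case using shift[of "of_int i * p" "of_int i * p + p"] by (simp add: algebra_simps)
    next
      case (step2 i)
      then show ?case using shift[of "of_int (i - 1) * p" "of_int (i - 1) * p + p"] by (simp add: algebra_simps)
    qed simp
    then show ?thesis using mid[OF m] by simp
  qed simp
qed

text \<open>The argument of Hardy, Littlewood and Polya. By the intermediate value theorem \<open>w\<close> takes the same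
  value \<open>c\<close> at two points at distance \<open>\<pi>\<close>. The Dirichlet inequality for \<open>w - c\<close> on the two
  halves of the period bounds \<open>\<integral> (w - c)\<^sup>2\<close> by \<open>\<integral> (w')\<^sup>2\<close>, and since \<open>w\<close> has mean zero,
  \<open>\<integral> (w - c)\<^sup>2\<close> is at least \<open>\<integral> w\<^sup>2\<close>.\<close>

lemma wirtinger_mean_zero:
  fixes w w' :: "real \<Rightarrow> real"
  assumes deriv: "\<And>t. (w has_field_derivative w' t) (at t)"
    and cont: "continuous_on UNIV w'"
    and per: "\<And>t. w (t + 2 * pi) = w t"
    and mean: "integral {0..2 * pi} w = 0"
  shows "integral {0..2 * pi} (\<lambda>t. (w t)\<^sup>2) \<le> integral {0..2 * pi} (\<lambda>t. (w' t)\<^sup>2)"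
proof -
  have cw: "continuous_on S w" for S
    using deriv DERIV_isCont continuous_at_imp_continuous_on by blast
  have cw': "continuous_on S w'" for S
    using cont continuous_on_subset by blast
  have per': "w' (t + 2 * pi) = w' t" for t
    by (rule deriv_periodic[OF deriv per])
  obtain y where y: "w y = w (y + pi)"
  proof -
    define d where "d t = w t - w (t + pi)" for t
    have dpi: "d pi = - d 0" using per[of 0] by (simp add: d_def)
    have cd: "continuous_on {0..pi} d" unfolding d_def
      by (intro continuous_intros cw continuous_on_compose2[OF cw[of UNIV]]) auto
    have "\<exists>y. d y = 0"
    proof (cases "d 0 \<le> 0")
      case True
      then show ?thesis using IVT'[of d 0 0 pi] dpi cd by auto
    next
      case False
      then show ?thesis using IVT2'[of d pi 0 0] dpi cd by auto
    qed
    then show ?thesis using that by (auto simp: d_def)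
  qed
  define c where "c = w y"
  define v where "v t = w t - c" for t
  have dv: "(v has_field_derivative w' t) (at t)" for t
    unfolding v_def by (auto intro!: derivative_eq_intros deriv)
  have cv: "continuous_on S v" for S unfolding v_def by (intro continuous_intros cw)
  have pv: "v (t + 2 * pi) = v t" for t by (simp add: v_def per)
  have z: "v y = 0" "v (y + pi) = 0" "v (y + pi + pi) = 0"
    using y per[of y] by (simp_all add: v_def c_def algebra_simps)
  have split: "integral {0..2 * pi} g = integral {y..y + pi} g + integral {y + pi..y + pi + pi} g"
    if "continuous_on UNIV g" "\<And>t. g (t + 2 * pi) = g t" for g :: "real \<Rightarrow> real"
  proof -
    have "integral {0..2 * pi} g = integral {y..y + 2 * pi} g"
      using integral_period_shift[OF that, of y] by simp
    also have "\<dots> = integral {y..y + pi} g + integral {y + pi..y + 2 * pi} g"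
      by (rule Henstock_Kurzweil_Integration.integral_combine[symmetric])
        (auto intro!: integrable_continuous_real continuous_on_subset[OF that(1)])
    finally show ?thesis by (simp add: algebra_simps)
  qed
  have "integral {0..2 * pi} (\<lambda>t. (v t)\<^sup>2) \<le> integral {0..2 * pi} (\<lambda>t. (w' t)\<^sup>2)"
    using dirichlet_poincare_pi[OF dv cont z(1,2)] dirichlet_poincare_pi[OF dv cont z(2,3)]
    split[of "\<lambda>t. (v t)\<^sup>2"] split[of "\<lambda>t. (w' t)\<^sup>2"]
    by (simp add: continuous_on_power cv cw' per' per pv)
  moreover have "integral {0..2 * pi} (\<lambda>t. (v t)\<^sup>2)
      = integral {0..2 * pi} (\<lambda>t. (w t)\<^sup>2 - 2 * c * w t + c\<^sup>2)"
    by (simp add: v_def power2_diff algebra_simps)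
  moreover have "\<dots> = integral {0..2 * pi} (\<lambda>t. (w t)\<^sup>2) - 2 * c * integral {0..2 * pi} w + 2 * pi * c\<^sup>2"
    by (subst integral_add integral_diff integral_mult_right;
        (intro integrable_continuous_real continuous_intros cw)?)+ simp
  moreover have "0 \<le> 2 * pi * c\<^sup>2" by simp
  ultimately show ?thesis unfolding mean by linarith
qed

section \<open>Fibre integrals and comparison with the ground state\<close>

lemma periodic_mono_imp_deriv_zero:
  fixes P P' :: "real \<Rightarrow> real"
  assumes deriv: "\<And>x. (P has_field_derivative P' x) (at x)"
    and nonneg: "\<And>x. P' x \<ge> 0" and per: "\<And>x. P (x + p) = P x" and "p > 0"
  shows "P' x = 0"
proof -
  have mono: "P s \<le> P t" if "s \<le> t" for s t
    using DERIV_nonneg_imp_nondecreasing[OF that] deriv nonneg by blast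
  define l where "l = x - p / 2"
  have "P t = P l" if "t \<in> {l<..<l + p}" for t
    using mono[of l t] mono[of t "l + p"] per[of l] that by auto
  then have "\<forall>\<^sub>F t in nhds x. P t = P l"
    using \<open>p > 0\<close> by (intro eventually_nhds_in_open[of "{l<..<l + p}", THEN eventually_mono])
      (auto simp: l_def)
  then have "(P has_field_derivative 0) (at x)"
    using DERIV_cong_ev[OF refl _ refl, of P "\<lambda>_. P l" x 0] by auto
  then show ?thesis using deriv DERIV_unique by blast
qed

lemma periodic_nonneg_integral_zero:
  fixes g :: "real \<Rightarrow> real"
  assumes cont: "continuous_on UNIV g" and per: "\<And>t. g (t + p) = g t" and "p > 0"
    and nonneg: "\<And>t. g t \<ge> 0" and int: "integral {0..p} g = 0"
  shows "g t = 0"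
proof -
  have "integral {t..t + p} g = 0"
    using integral_period_shift[OF cont per, of t] int \<open>p > 0\<close> by simp
  then have "\<forall>s\<in>{t..t + p}. g s = 0"
    by (subst (asm) integral_eq_0_iff)
      (use \<open>p > 0\<close> nonneg continuous_on_subset[OF cont] in auto)
  then show ?thesis using \<open>p > 0\<close> by simp
qed

definition fibre_integral :: "(real \<times> real \<Rightarrow> real) \<Rightarrow> real \<Rightarrow> real" where
  "fibre_integral h x = integral {0..2 * pi} (\<lambda>y. h (x, y))"

lemma continuous_slice:
  assumes "continuous_on UNIV h"
  shows "continuous_on S (\<lambda>y. h (x, y))"
  by (rule continuous_on_compose2[OF assms]) (auto intro: continuous_intros)

lemma fibre_integrable:
  fixes h :: "real \<times> real \<Rightarrow> real"
  assumes "continuous_on UNIV h"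
  shows "(\<lambda>y. h (x, y)) integrable_on {0..2 * pi}"
  by (intro integrable_continuous_real continuous_slice assms)

lemma fibre_integral_deriv:
  assumes "\<And>x y. ((\<lambda>s. h (s, y)) has_field_derivative h' (x, y)) (at x)"
    and "continuous_on UNIV h" "continuous_on UNIV h'"
  shows "(fibre_integral h has_field_derivative fibre_integral h' x) (at x)"
proof -
  have "((\<lambda>x. integral (cbox 0 (2 * pi)) (\<lambda>y. h (x, y))) has_field_derivative
      integral (cbox 0 (2 * pi)) (\<lambda>y. h' (x, y))) (at x within UNIV)"
    by (rule leibniz_rule_field_derivative)
      (use assms fibre_integrable[of h] in \<open>auto intro: continuous_on_subset\<close>)
  then show ?thesis by (simp add: fibre_integral_def[abs_def])
qed

lemma fibre_integral_add:
  "continuous_on UNIV h \<Longrightarrow> continuous_on UNIV k \<Longrightarrow>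
    fibre_integral (\<lambda>p. h p + k p) x = fibre_integral h x + fibre_integral k x"
  unfolding fibre_integral_def by (intro integral_add fibre_integrable)

lemma fibre_integral_cmult:
  "fibre_integral (\<lambda>p. c (fst p) * h p) x = c x * fibre_integral h x"
  unfolding fibre_integral_def by simp

lemma fibre_integral_y_deriv:
  assumes "\<And>x y. ((\<lambda>t. h (x, t)) has_field_derivative h' (x, y)) (at y)"
    and "\<And>x y. h (x, y + 2 * pi) = h (x, y)"
  shows "fibre_integral h' x = 0"
proof -
  have "((\<lambda>y. h' (x, y)) has_integral h (x, 2 * pi) - h (x, 0)) {0..2 * pi}"
    by (rule fundamental_theorem_of_calculus)
      (auto simp: has_real_derivative_iff_has_vector_derivative[symmetric]
        intro: has_field_derivative_at_within assms)
  then show ?thesis using assms(2)[of x 0] by (simp add: fibre_integral_def integral_unique)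
qed

text \<open>This is where \<open>F\<close> enters as a ground state. Write \<open>g = F u\<close> and let \<open>M(x)\<close> be the integral of
  \<open>u\<^sup>2\<close> over the fibre above \<open>x\<close>. The equations for \<open>g\<close> and \<open>F\<close> give
  \<open>(F\<^sup>2 M')' = 2 F\<^sup>2 \<integral> u\<^sub>x\<^sup>2 + 2 F\<^sup>2 \<integral> (u\<^sub>y\<^sup>2 - u\<^sup>2) + 2 (1 - \<nu>) Q F\<^sup>2 M\<close>, with integrals over the fibre,
  and each of the three terms is nonnegative: the second by Wirtinger's inequality, as the fibres of \<open>g\<close>
  have mean zero. So \<open>F\<^sup>2 M'\<close> is both periodic and nondecreasing, hence constant, and all three terms
  vanish: \<open>u\<close> does not depend on \<open>x\<close>, and \<open>u = 0\<close> if \<open>\<nu> < 1\<close>.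

  In the proof \<open>r\<close> is the logarithmic derivative of \<open>F\<close>, \<open>N = F\<^sup>2 M\<close>, and \<open>P = F\<^sup>2 M'\<close> is
  expressed through \<open>N\<close> and \<open>r\<close>.\<close>

lemma mean_zero_fibres_proportional:
  fixes g gx gxx gy gyy :: "real \<times> real \<Rightarrow> real" and F F' Q :: "real \<Rightarrow> real"
  assumes gx: "\<And>x y. ((\<lambda>s. g (s, y)) has_field_derivative gx (x, y)) (at x)"
    and gxx: "\<And>x y. ((\<lambda>s. gx (s, y)) has_field_derivative gxx (x, y)) (at x)"
    and gy: "\<And>x y. ((\<lambda>t. g (x, t)) has_field_derivative gy (x, y)) (at y)"
    and gyy: "\<And>x y. ((\<lambda>t. gy (x, t)) has_field_derivative gyy (x, y)) (at y)"
    and cont[continuous_intros]: "continuous_on UNIV g" "continuous_on UNIV gx" "continuous_on UNIV gxx"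
      "continuous_on UNIV gy" "continuous_on UNIV gyy"
    and perx: "\<And>x y. g (x + 2 * pi, y) = g (x, y)" and pery: "\<And>x y. g (x, y + 2 * pi) = g (x, y)"
    and pde: "\<And>x y. gxx (x, y) + gyy (x, y) = - (\<nu> * Q x * g (x, y))"
    and mean: "\<And>x. fibre_integral g x = 0"
    and F: "\<And>x. F x > 0" "\<And>x. F (x + 2 * pi) = F x"
    and F': "\<And>x. (F has_field_derivative F' x) (at x)"
    and F'': "\<And>x. (F' has_field_derivative (1 - Q x) * F x) (at x)"
    and Q: "\<And>x. Q x > 0" and \<nu>: "\<nu> \<le> 1"
  shows "gx (x, y) = F' x / F x * g (x, y)" "\<nu> < 1 \<Longrightarrow> g (x, y) = 0"
proof -
  have gx_perx: "gx (x + 2 * pi, y) = gx (x, y)" for x y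
    by (rule deriv_periodic[where k = "\<lambda>s. g (s, y)"]) (use gx perx in auto)
  have gy_pery: "gy (x, y + 2 * pi) = gy (x, y)" for x y
    by (rule deriv_periodic[where k = "\<lambda>t. g (x, t)"]) (use gy pery in auto)
  have F'_per: "F' (x + 2 * pi) = F' x" for x
    by (rule deriv_periodic[where k = F]) (use F' F in auto)
  have gx_pery: "gx (x, y + 2 * pi) = gx (x, y)" for x y
    using gx[of "y + 2 * pi" x] gx[of y x] DERIV_unique by (simp add: pery) blast
  have slices: "continuous_on S (\<lambda>y. g (x, y))" "continuous_on S (\<lambda>y. gx (x, y))"
    "continuous_on S (\<lambda>y. gy (x, y))" for S x
    by (intro continuous_slice cont)+
  define r where "r x = F' x / F x" for x
  define N where "N = fibre_integral (\<lambda>p. g p * g p)"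
  define J where "J = fibre_integral (\<lambda>p. g p * gx p)"
  define X where "X = fibre_integral (\<lambda>p. gx p * gx p)"
  define Y where "Y = fibre_integral (\<lambda>p. gy p * gy p)"
  have N': "(N has_field_derivative 2 * J x) (at x)" for x
  proof -
    have "(N has_field_derivative fibre_integral (\<lambda>p. 2 * (g p * gx p)) x) (at x)"
      unfolding N_def
      by (rule fibre_integral_deriv) (auto intro!: derivative_eq_intros gx continuous_intros)
    then show ?thesis using fibre_integral_cmult[of "\<lambda>_. 2"] by (simp add: J_def)
  qed
  have Ygyy: "fibre_integral (\<lambda>p. g p * gyy p) x = - Y x" for x
  proof -
    have "fibre_integral (\<lambda>p. gy p * gy p + g p * gyy p) x = 0"
      by (rule fibre_integral_y_deriv[where h = "\<lambda>p. g p * gy p"])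
        (auto intro!: derivative_eq_intros gy gyy simp: pery gy_pery)
    then show ?thesis by (subst (asm) fibre_integral_add) (auto intro!: continuous_intros simp: Y_def)
  qed
  have J': "(J has_field_derivative X x - \<nu> * Q x * N x + Y x) (at x)" for x
  proof -
    have "(J has_field_derivative fibre_integral (\<lambda>p. gx p * gx p + g p * gxx p) x) (at x)"
      unfolding J_def
      by (rule fibre_integral_deriv) (auto intro!: derivative_eq_intros gx gxx continuous_intros)
    moreover have "fibre_integral (\<lambda>p. gx p * gx p + g p * gxx p) x
        = X x + fibre_integral (\<lambda>p. g p * gxx p) x"
      unfolding X_def by (rule fibre_integral_add) (auto intro!: continuous_intros)
    moreover have "fibre_integral (\<lambda>p. g p * gxx p) x + fibre_integral (\<lambda>p. g p * gyy p) x
        = fibre_integral (\<lambda>p. g p * gxx p + g p * gyy p) x"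
      by (rule fibre_integral_add[symmetric]) (auto intro!: continuous_intros)
    moreover have "(\<lambda>p. g p * gxx p + g p * gyy p) = (\<lambda>p. - (\<nu> * Q (fst p)) * (g p * g p))"
      using pde by (auto simp flip: distrib_left)
    moreover have "fibre_integral \<dots> x = - (\<nu> * Q x) * N x"
      unfolding N_def by (rule fibre_integral_cmult)
    ultimately show ?thesis using Ygyy[of x] by (simp add: algebra_simps)
  qed
  have r': "(r has_field_derivative (1 - Q x) - (r x)\<^sup>2) (at x)" for x
    unfolding r_def using F(1)[of x]
    by (auto intro!: derivative_eq_intros F' F'' simp: field_simps power2_eq_square)
  define E where "E x = fibre_integral (\<lambda>p. (gx p - r (fst p) * g p)\<^sup>2) x" for x
  have E: "E x = X x - 2 * r x * J x + (r x)\<^sup>2 * N x" for x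
  proof -
    have cr: "continuous_on UNIV r"
      using r' DERIV_isCont continuous_at_imp_continuous_on by blast
    have "E x = fibre_integral (\<lambda>p. (gx p * gx p + (- 2 * r (fst p)) * (g p * gx p)) + (r (fst p))\<^sup>2 * (g p * g p)) x"
      unfolding E_def by (rule arg_cong[where f = "\<lambda>h. fibre_integral h x"])
        (auto simp: power2_eq_square algebra_simps)
    also have "\<dots> = X x + (- 2 * r x) * J x + (r x)\<^sup>2 * N x"
      using fibre_integral_cmult[of "\<lambda>x. - 2 * r x" "\<lambda>p. g p * gx p" x]
        fibre_integral_cmult[of "\<lambda>x. (r x)\<^sup>2" "\<lambda>p. g p * g p" x]
      by (subst fibre_integral_add, (auto intro!: continuous_intros continuous_on_compose2[OF cr])[2],
          subst fibre_integral_add, (auto intro!: continuous_intros continuous_on_compose2[OF cr])[2])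
        (simp only: X_def J_def N_def)
    finally show ?thesis by simp
  qed
  have E_nonneg: "E x \<ge> 0" for x unfolding E_def fibre_integral_def
    by (rule integral_nonneg)
      (auto intro!: integrable_continuous_real continuous_intros slices)
  have N_nonneg: "N x \<ge> 0" for x unfolding N_def fibre_integral_def
    by (rule integral_nonneg)
      (auto intro!: integrable_continuous_real continuous_intros slices)
  have NY: "N x \<le> Y x" for x
    using wirtinger_mean_zero[of "\<lambda>y. g (x, y)" "\<lambda>y. gy (x, y)"] gy pery mean[of x]
    by (auto simp: N_def Y_def fibre_integral_def power2_eq_square intro: slices)
  define P where "P x = 2 * J x - 2 * r x * N x" for x
  define P' where "P' x = 2 * E x + 2 * (Y x - N x) + 2 * (1 - \<nu>) * Q x * N x" for x
  have P: "(P has_field_derivative P' x) (at x)" for x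
    unfolding P_def P'_def E
    by (auto intro!: derivative_eq_intros J' N' r' simp: algebra_simps power2_eq_square)
  have terms: "2 * E x \<ge> 0" "2 * (Y x - N x) \<ge> 0" "2 * (1 - \<nu>) * Q x * N x \<ge> 0" for x
    using E_nonneg[of x] NY[of x] N_nonneg[of x] Q[of x] \<nu> by (auto intro!: mult_nonneg_nonneg)
  have P0: "P' x = 0" for x
  proof (rule periodic_mono_imp_deriv_zero[OF P])
    show "P' x \<ge> 0" for x unfolding P'_def using terms[of x] by linarith
    show "P (x + 2 * pi) = P x" for x
      unfolding P_def J_def N_def r_def fibre_integral_def by (simp add: perx gx_perx F F'_per)
  qed simp
  have E0: "E x = 0" and N0: "(1 - \<nu>) * Q x * N x = 0" for x
    using P0[of x] terms[of x] unfolding P'_def by linarith+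
  have "(gx (x, y) - r x * g (x, y))\<^sup>2 = 0"
    by (rule periodic_nonneg_integral_zero[where p = "2 * pi" and g = "\<lambda>y. (gx (x, y) - r x * g (x, y))\<^sup>2"])
      (use E0[of x] in \<open>auto simp: E_def fibre_integral_def pery gx_pery
        intro!: continuous_intros slices\<close>)
  then show "gx (x, y) = F' x / F x * g (x, y)" by (simp add: r_def)
  assume "\<nu> < 1"
  then have "N x = 0" using N0[of x] Q[of x] by auto
  then have "g (x, y) * g (x, y) = 0"
    by (intro periodic_nonneg_integral_zero[where p = "2 * pi" and g = "\<lambda>y. g (x, y) * g (x, y)"])
      (auto simp: N_def fibre_integral_def pery intro!: continuous_intros slices)
  then show "g (x, y) = 0" by simp
qed

section \<open>The structure of eigenfunctions up to the eigenvalue one\<close>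

definition smooth :: "(real \<times> real \<Rightarrow> real) \<Rightarrow> bool" where
  "smooth f \<longleftrightarrow> (\<forall>k. C_k k f)"

lemma smooth_continuous: "smooth f \<Longrightarrow> continuous_on UNIV f"
  unfolding smooth_def using C_k.simps(1) by blast

lemma smooth_partial: "smooth f \<Longrightarrow> smooth (partial_x f)" "smooth f \<Longrightarrow> smooth (partial_y f)"
  unfolding smooth_def using C_k.simps(2) by blast+

lemma smooth_partial_deriv:
  assumes "smooth f"
  shows "((\<lambda>s. f (s, y)) has_field_derivative partial_x f (x, y)) (at x)"
    and "((\<lambda>t. f (x, t)) has_field_derivative partial_y f (x, y)) (at y)"
proof -
  have "C_k (Suc 0) f" using assms unfolding smooth_def by blast
  then show "((\<lambda>s. f (s, y)) has_field_derivative partial_x f (x, y)) (at x)"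
    "((\<lambda>t. f (x, t)) has_field_derivative partial_y f (x, y)) (at y)"
    by (auto simp: partial_x_def partial_y_def DERIV_deriv_iff_real_differentiable)
qed

lemma harmonic_oscillator:
  fixes w w' :: "real \<Rightarrow> real"
  assumes w: "\<And>y. (w has_field_derivative w' y) (at y)"
    and w': "\<And>y. (w' has_field_derivative - w y) (at y)"
  shows "w y = w 0 * cos y + w' 0 * sin y"
proof -
  have "((\<lambda>y. w y * cos y - w' y * sin y) has_field_derivative 0) (at y)" for y
    by (auto intro!: derivative_eq_intros w w')
  then have A: "w y * cos y - w' y * sin y = w 0"
    using DERIV_isconst_all[of "\<lambda>y. w y * cos y - w' y * sin y" y 0] by simp
  have "((\<lambda>y. w y * sin y + w' y * cos y) has_field_derivative 0) (at y)" for y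
    by (auto intro!: derivative_eq_intros w w')
  then have B: "w y * sin y + w' y * cos y = w' 0"
    using DERIV_isconst_all[of "\<lambda>y. w y * sin y + w' y * cos y" y 0] by simp
  have "w 0 * cos y + w' 0 * sin y = w y * ((sin y)\<^sup>2 + (cos y)\<^sup>2)"
    unfolding A[symmetric] B[symmetric] by algebra
  then show ?thesis by simp
qed

text \<open>Up to the eigenvalue \<open>1\<close> separation of variables leaves only the lowest Fourier modes in \<open>y\<close>. The
  fibre mean \<open>a\<close> of \<open>f\<close> solves an ordinary differential equation, and \<open>f - a\<close> has fibres of mean
  zero, so by the previous section it is \<open>F(x) w(y)\<close>, and it vanishes unless \<open>\<nu> = 1\<close>. In that
  case the equation turns into \<open>w'' = - w\<close>.\<close>

lemma eigenspace_structure: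
  assumes f: "f \<in> eigenspace Q \<nu>" and \<nu>: "\<nu> \<le> 1"
    and Q: "\<And>x. Q x > 0" and contQ: "continuous_on UNIV Q"
    and F: "\<And>x. F x > 0" "\<And>x. F (x + 2 * pi) = F x"
    and F': "\<And>x. (F has_field_derivative F' x) (at x)"
    and F'': "\<And>x. (F' has_field_derivative (1 - Q x) * F x) (at x)"
  obtains a a' b c where
    "\<And>x. (a has_field_derivative a' x) (at x)"
    "\<And>x. (a' has_field_derivative - (\<nu> * Q x * a x)) (at x)"
    "\<And>x. a (x + 2 * pi) = a x"
    "\<And>x y. f (x, y) = a x + F x * (b * cos y + c * sin y)"
    "\<nu> \<noteq> 1 \<Longrightarrow> b = 0 \<and> c = 0"
proof -
  define fx fy where "fx = partial_x f" and "fy = partial_y f"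
  define fxx fyy where "fxx = partial_x fx" and "fyy = partial_y fy"
  have sm0: "smooth f" and perx: "f (x + 2 * pi, y) = f (x, y)" and pery: "f (x, y + 2 * pi) = f (x, y)" for x y
    using f unfolding eigenspace_def smooth_on_torus_def smooth_def by blast+
  have sm: "smooth f" "smooth fx" "smooth fy" "smooth fxx" "smooth fyy"
    unfolding fx_def fy_def fxx_def fyy_def by (intro smooth_partial sm0)+
  have pde: "fxx (x, y) + fyy (x, y) = - (\<nu> * Q x * f (x, y))" for x y
  proof -
    have "- ((fxx (x, y) + fyy (x, y)) / Q x) = \<nu> * f (x, y)"
      using f unfolding eigenspace_def laplace_beltrami_def fx_def fy_def fxx_def fyy_def by auto
    then show ?thesis using Q[of x] by (simp add: field_simps)
  qed
  note dx = smooth_partial_deriv(1)[OF sm(1), folded fx_def] smooth_partial_deriv(1)[OF sm(2), folded fxx_def]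
  note dy = smooth_partial_deriv(2)[OF sm(1), folded fy_def] smooth_partial_deriv(2)[OF sm(3), folded fyy_def]
  note cont = sm[THEN smooth_continuous]
  have fy_pery: "fy (x, y + 2 * pi) = fy (x, y)" for x y
    by (rule deriv_periodic[where k = "\<lambda>t. f (x, t)"]) (rule dy pery)+
  define a a' where "a x = fibre_integral f x / (2 * pi)" and "a' x = fibre_integral fx x / (2 * pi)" for x
  have a: "(a has_field_derivative a' x) (at x)" for x
    unfolding a_def a'_def by (intro DERIV_cdivide fibre_integral_deriv dx cont)
  have a': "(a' has_field_derivative - (\<nu> * Q x * a x)) (at x)" for x
  proof -
    have "(a' has_field_derivative fibre_integral fxx x / (2 * pi)) (at x)"
      unfolding a'_def by (intro DERIV_cdivide fibre_integral_deriv dx cont)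
    moreover have "fibre_integral fxx x + fibre_integral fyy x = fibre_integral (\<lambda>p. fxx p + fyy p) x"
      by (intro fibre_integral_add[symmetric] cont)
    moreover have "fibre_integral fyy x = 0"
      by (rule fibre_integral_y_deriv[OF dy(2) fy_pery])
    moreover have "(\<lambda>p. fxx p + fyy p) = (\<lambda>p. - (\<nu> * Q (fst p)) * f p)"
      using pde by auto
    moreover have "fibre_integral \<dots> x = - (\<nu> * Q x) * fibre_integral f x"
      by (rule fibre_integral_cmult)
    ultimately show ?thesis by (simp add: a_def)
  qed
  have a_per: "a (x + 2 * pi) = a x" for x
    by (simp add: a_def fibre_integral_def perx)
  define g where "g p = f p - a (fst p)" for p
  define gx where "gx p = fx p - a' (fst p)" for p
  define gxx where "gxx p = fxx p + \<nu> * Q (fst p) * a (fst p)" for p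
  have ca: "continuous_on S a" and ca': "continuous_on S a'" for S
    by (rule DERIV_continuous_on[OF has_field_derivative_at_within], rule a a')+
  have g1: "((\<lambda>s. g (s, y)) has_field_derivative gx (x, y)) (at x)" for x y
    unfolding g_def gx_def fst_conv by (rule DERIV_diff) (rule dx a)+
  have g2: "((\<lambda>s. gx (s, y)) has_field_derivative gxx (x, y)) (at x)" for x y
  proof -
    have "((\<lambda>s. fx (s, y) - a' s) has_field_derivative fxx (x, y) - - (\<nu> * Q x * a x)) (at x)"
      by (rule DERIV_diff) (rule dx a')+
    then show ?thesis by (simp only: gx_def gxx_def fst_conv diff_minus_eq_add)
  qed
  have g3: "((\<lambda>t. g (x, t)) has_field_derivative fy (x, y)) (at y)" for x y
  proof -
    have "((\<lambda>t. f (x, t) - a x) has_field_derivative fy (x, y) - 0) (at y)"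
      by (rule DERIV_diff) (rule dy DERIV_const)+
    then show ?thesis by (simp only: g_def fst_conv diff_zero)
  qed
  note g = g1 g2 g3
  have gxx_eq: "gxx = (\<lambda>p. - (\<nu> * Q (fst p) * g p) - fyy p)"
  proof
    fix p show "gxx p = - (\<nu> * Q (fst p) * g p) - fyy p"
      using pde[of "fst p" "snd p"] unfolding gxx_def g_def by (simp add: algebra_simps)
  qed
  have cQ: "continuous_on S Q" for S
    using contQ continuous_on_subset by blast
  have cg: "continuous_on UNIV g" "continuous_on UNIV gx" "continuous_on UNIV gxx"
    unfolding g_def gx_def gxx_def
    by (intro continuous_intros cont continuous_on_compose2[OF ca] continuous_on_compose2[OF ca']
        continuous_on_compose2[OF cQ]; auto)+
  have mean: "fibre_integral g x = 0" for x
  proof -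
    have "fibre_integral g x = fibre_integral (\<lambda>p. f p + - a (fst p) * 1) x"
      by (simp add: g_def fibre_integral_def)
    also have "\<dots> = fibre_integral f x + - a x * fibre_integral (\<lambda>_. 1) x"
      using fibre_integral_cmult[of "\<lambda>x. - a x" "\<lambda>_. 1" x]
      by (subst fibre_integral_add) (auto intro!: cont continuous_intros continuous_on_compose2[OF ca])
    finally show ?thesis by (simp add: a_def fibre_integral_def)
  qed
  have gperx: "g (x + 2 * pi, y) = g (x, y)" and gpery: "g (x, y + 2 * pi) = g (x, y)" for x y
    by (simp_all add: g_def perx pery a_per)
  have gpde: "gxx (x, y) + fyy (x, y) = - (\<nu> * Q x * g (x, y))" for x y
    by (simp add: gxx_eq)
  note proportional = mean_zero_fibres_proportional[where g = g and gx = gx and gxx = gxx and gy = fy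
      and gyy = fyy, OF g1 g2 g3 dy(2) cg cont(3) cont(5) gperx gpery gpde mean F F' F'' Q \<nu>]
  have concl: "gx (x, y) = F' x / F x * g (x, y)" "\<nu> < 1 \<Longrightarrow> g (x, y) = 0" for x y
    by (fact proportional)+
  show thesis
  proof (cases "\<nu> = 1")
    case False
    then show thesis
      using that[of a a' 0 0] a a' a_per concl(2) \<nu> by (auto simp: g_def)
  next
    case True
    define w w' where "w y = g (0, y) / F 0" and "w' y = fy (0, y) / F 0" for y
    have gF: "g (x, y) = F x * w y" for x y
    proof -
      have "((\<lambda>s. g (s, y) / F s) has_field_derivative 0) (at s)" for s
        using F(1)[of s] by (auto intro!: derivative_eq_intros g F' simp: concl)
      then have "g (x, y) / F x = g (0, y) / F 0"
        using DERIV_isconst_all[of "\<lambda>s. g (s, y) / F s"] by blast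
      then show ?thesis using F(1)[of x] unfolding w_def by (simp add: field_simps)
    qed
    have w: "(w has_field_derivative w' y) (at y)" for y
      unfolding w_def w'_def by (intro DERIV_cdivide g)
    have w': "(w' has_field_derivative - w y) (at y)" for y
    proof -
      have "gx (x, y) = F' x * w y" for x
        using concl(1)[of x y] gF F(1)[of x] by simp
      then have "((\<lambda>s. gx (s, y)) has_field_derivative (1 - Q 0) * F 0 * w y) (at 0)"
        by (simp add: DERIV_cmult_right F'')
      then have "gxx (0, y) = (1 - Q 0) * F 0 * w y"
        using g(2) DERIV_unique by blast
      then have "fyy (0, y) = - w y * F 0"
        unfolding gxx_eq by (simp add: gF True algebra_simps)
      then have "- w y = fyy (0, y) / F 0" using F(1)[of 0] by simp
      then show ?thesis unfolding w'_def by (simp add: DERIV_cdivide dy)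
    qed
    have "f (x, y) = a x + F x * (w 0 * cos y + w' 0 * sin y)" for x y
      using gF[of x y] harmonic_oscillator[OF w w', of y] by (simp add: g_def)
    then show thesis using that[of a a' "w 0" "w' 0"] a a' a_per True by blast
  qed
qed

section \<open>Separating the eigenspaces by five linear functionals\<close>

text \<open>The equation for \<open>F\<close> says that \<open>F(x) cos y\<close> satisfies the eigenvalue equation with eigenvalue
  \<open>1\<close>. The bound on \<open>Q\<close> has to stay below \<open>(7 / 5)\<^sup>2\<close>, the constant of the Dirichlet inequality
  used for \<open>sturm_three_zeros\<close>.\<close>

locale liouville_ground_state =
  fixes Q F F' :: "real \<Rightarrow> real"
  assumes Q_pos: "Q x > 0" and Q_le: "Q x \<le> 19 / 10" and Q_cont: "continuous_on UNIV Q"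
    and Q_per: "Q (x + 2 * pi) = Q x"
    and F_pos: "F x > 0" and F_per: "F (x + 2 * pi) = F x"
    and F_deriv: "(F has_field_derivative F' x) (at x)"
    and F'_deriv: "(F' has_field_derivative (1 - Q x) * F x) (at x)"
begin

text \<open>A nonzero combination \<open>A\<close> of solutions of \<open>a'' = - \<nu> Q a\<close> with parameters \<open>\<nu> \<le> 1\<close> oscillates too
  slowly to vanish at three equidistant points of the circle. Solutions for different parameters are
  orthogonal with weight \<open>Q\<close>, so \<open>\<integral> (A')\<^sup>2 \<le> \<integral> Q A\<^sup>2\<close>. On the other hand \<open>A\<close> satisfies Dirichlet
  conditions on three arcs of length \<open>2 \<pi> / 3\<close>, and since \<open>14 / 10\<close> is less than \<open>3 / 2\<close> this gives
  \<open>(14 / 10)\<^sup>2 \<integral> A\<^sup>2 \<le> \<integral> (A')\<^sup>2\<close>. As \<open>Q\<close> is smaller than \<open>(14 / 10)\<^sup>2\<close>, the combination vanishes,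
  and by orthogonality each of its members does.\<close>

lemma sturm_three_zeros:
  fixes a a' :: "real \<Rightarrow> real \<Rightarrow> real"
  assumes T: "finite T" "\<And>\<nu>. \<nu> \<in> T \<Longrightarrow> \<nu> \<le> 1"
    and a: "\<And>\<nu> x. \<nu> \<in> T \<Longrightarrow> (a \<nu> has_field_derivative a' \<nu> x) (at x)"
    and a': "\<And>\<nu> x. \<nu> \<in> T \<Longrightarrow> (a' \<nu> has_field_derivative - (\<nu> * Q x * a \<nu> x)) (at x)"
    and per: "\<And>\<nu> x. \<nu> \<in> T \<Longrightarrow> a \<nu> (x + 2 * pi) = a \<nu> x"
    and zeros: "(\<Sum>\<nu>\<in>T. a \<nu> 0) = 0" "(\<Sum>\<nu>\<in>T. a \<nu> (2 * pi / 3)) = 0" "(\<Sum>\<nu>\<in>T. a \<nu> (4 * pi / 3)) = 0"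
    and \<nu>: "\<nu> \<in> T"
  shows "a \<nu> x = 0"
proof -
  define I :: "(real \<Rightarrow> real) \<Rightarrow> real" where "I = integral {0..2 * pi}"
  have ca: "continuous_on S (a \<nu>)" and ca': "continuous_on S (a' \<nu>)" if "\<nu> \<in> T" for S \<nu>
    by (rule DERIV_continuous_on[OF has_field_derivative_at_within], rule a[OF that] a'[OF that])+
  have cQ: "continuous_on S Q" for S using Q_cont continuous_on_subset by blast
  have per': "a' \<nu> (x + 2 * pi) = a' \<nu> x" if mem: "\<nu> \<in> T" for \<nu> x
    by (rule deriv_periodic[OF a[OF mem] per[OF mem]])
  have I_deriv: "I h = 0"
    if "\<And>x. (H has_field_derivative h x) (at x)" "H (2 * pi) = H 0" for H h :: "real \<Rightarrow> real"
  proof -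
    have "(h has_integral H (2 * pi) - H 0) {0..2 * pi}"
      by (rule fundamental_theorem_of_calculus)
        (auto simp: has_real_derivative_iff_has_vector_derivative[symmetric]
          intro: has_field_derivative_at_within that)
    then show ?thesis using that(2) by (simp add: I_def integral_unique)
  qed
  define M where "M \<mu> \<nu> = I (\<lambda>x. Q x * (a \<mu> x * a \<nu> x))" for \<mu> \<nu>
  have parts: "I (\<lambda>x. a' \<mu> x * a' \<nu> x) = \<mu> * M \<mu> \<nu>" if "\<mu> \<in> T" "\<nu> \<in> T" for \<mu> \<nu>
  proof -
    have "I (\<lambda>x. a' \<mu> x * a' \<nu> x - \<mu> * (Q x * (a \<mu> x * a \<nu> x))) = 0"
      by (rule I_deriv[where H = "\<lambda>x. a' \<mu> x * a \<nu> x"])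
        (use per[OF that(2), of 0] per'[OF that(1), of 0] in
          \<open>auto intro!: derivative_eq_intros a[OF that(2)] a'[OF that(1)] simp: algebra_simps\<close>)
    then show ?thesis unfolding I_def M_def
      by (subst (asm) integral_diff)
        (auto intro!: integrable_continuous_real continuous_intros ca ca' cQ that)
  qed
  have sym: "M \<mu> \<nu> = M \<nu> \<mu>" for \<mu> \<nu> by (simp add: M_def mult.commute)
  have orth: "M \<mu> \<nu> = 0" if "\<mu> \<in> T" "\<nu> \<in> T" "\<mu> \<noteq> \<nu>" for \<mu> \<nu>
  proof -
    have "\<mu> * M \<mu> \<nu> = \<nu> * M \<mu> \<nu>"
      using parts[OF that(1,2)] parts[OF that(2,1)] sym[of \<mu> \<nu>] by (simp add: mult.commute)
    then show ?thesis using that(3) by simp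
  qed
  define A A' where "A x = (\<Sum>\<nu>\<in>T. a \<nu> x)" and "A' x = (\<Sum>\<nu>\<in>T. a' \<nu> x)" for x
  have A: "(A has_field_derivative A' x) (at x)" for x
    unfolding A_def A'_def by (auto intro!: derivative_eq_intros a)
  have cA: "continuous_on S A" and cA': "continuous_on S A'" for S
    unfolding A_def A'_def by (auto intro!: continuous_intros ca ca')
  have diag: "(\<Sum>\<mu>\<in>T. \<Sum>\<nu>\<in>T. c \<mu> * M \<mu> \<nu>) = (\<Sum>\<mu>\<in>T. c \<mu> * M \<mu> \<mu>)" for c
  proof (rule sum.cong[OF refl])
    fix \<mu> assume "\<mu> \<in> T"
    then have "(\<Sum>\<nu>\<in>T. c \<mu> * M \<mu> \<nu>) = (\<Sum>\<nu>\<in>T. if \<nu> = \<mu> then c \<mu> * M \<mu> \<mu> else 0)"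
      using orth by (intro sum.cong) auto
    then show "(\<Sum>\<nu>\<in>T. c \<mu> * M \<mu> \<nu>) = c \<mu> * M \<mu> \<mu>"
      using T(1) \<open>\<mu> \<in> T\<close> by simp
  qed
  have grad: "I (\<lambda>x. (A' x)\<^sup>2) = (\<Sum>\<mu>\<in>T. \<mu> * M \<mu> \<mu>)"
  proof -
    have "I (\<lambda>x. (A' x)\<^sup>2) = I (\<lambda>x. \<Sum>\<mu>\<in>T. \<Sum>\<nu>\<in>T. a' \<mu> x * a' \<nu> x)"
      by (simp add: A'_def power2_eq_square sum_product)
    also have "\<dots> = (\<Sum>\<mu>\<in>T. \<Sum>\<nu>\<in>T. I (\<lambda>x. a' \<mu> x * a' \<nu> x))"
      unfolding I_def
      by (subst integral_sum, (auto intro!: T integrable_continuous_real continuous_intros ca')[2],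
          rule sum.cong[OF refl], rule integral_sum)
        (auto intro!: T integrable_continuous_real continuous_intros ca')
    also have "\<dots> = (\<Sum>\<mu>\<in>T. \<Sum>\<nu>\<in>T. \<mu> * M \<mu> \<nu>)"
      by (intro sum.cong refl parts)
    finally show ?thesis using diag[of "\<lambda>\<mu>. \<mu>"] by simp
  qed
  have mass: "I (\<lambda>x. Q x * (A x)\<^sup>2) = (\<Sum>\<mu>\<in>T. M \<mu> \<mu>)"
  proof -
    have "I (\<lambda>x. Q x * (A x)\<^sup>2) = I (\<lambda>x. \<Sum>\<mu>\<in>T. \<Sum>\<nu>\<in>T. Q x * (a \<mu> x * a \<nu> x))"
      unfolding A_def power2_eq_square sum_product by (simp only: sum_distrib_left)
    also have "\<dots> = (\<Sum>\<mu>\<in>T. \<Sum>\<nu>\<in>T. M \<mu> \<nu>)"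
      unfolding I_def M_def
      by (subst integral_sum, (auto intro!: T integrable_continuous_real continuous_intros ca cQ)[2],
          rule sum.cong[OF refl], rule integral_sum)
        (auto intro!: T integrable_continuous_real continuous_intros ca cQ)
    finally show ?thesis using diag[of "\<lambda>_. 1"] by simp
  qed
  have M_nonneg: "M \<mu> \<mu> \<ge> 0" if "\<mu> \<in> T" for \<mu>
    unfolding M_def I_def using Q_pos[THEN less_imp_le]
    by (intro integral_nonneg) (auto intro!: integrable_continuous_real continuous_intros ca cQ that)
  have "(14 / 10)\<^sup>2 * I (\<lambda>x. (A x)\<^sup>2) \<le> I (\<lambda>x. (A' x)\<^sup>2)"
  proof -
    have A0: "A 0 = 0" "A (2 * pi / 3) = 0" "A (4 * pi / 3) = 0" "A (2 * pi) = 0"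
      using zeros per[of _ 0] by (simp_all add: A_def)
    have len: "14 / 10 * (2 * pi / 3 - 0) < pi" "14 / 10 * (4 * pi / 3 - 2 * pi / 3) < pi"
      "14 / 10 * (2 * pi - 4 * pi / 3) < pi" using pi_gt_zero by argo+
    have split: "I h = integral {0..2 * pi / 3} h + integral {2 * pi / 3..4 * pi / 3} h
        + integral {4 * pi / 3..2 * pi} h" if "continuous_on UNIV h" for h
    proof -
      have ih: "h integrable_on {s..t}" for s t
        by (rule integrable_continuous_real, rule continuous_on_subset[OF that]) auto
      have "integral {0..2 * pi / 3} h + integral {2 * pi / 3..4 * pi / 3} h = integral {0..4 * pi / 3} h"
        by (rule Henstock_Kurzweil_Integration.integral_combine) (auto intro: ih)
      moreover have "integral {0..4 * pi / 3} h + integral {4 * pi / 3..2 * pi} h = I h"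
        unfolding I_def by (rule Henstock_Kurzweil_Integration.integral_combine) (auto intro: ih)
      ultimately show ?thesis by simp
    qed
    show ?thesis
      using dirichlet_poincare[OF A cA' A0(1,2) _ _ len(1)]
        dirichlet_poincare[OF A cA' A0(2,3) _ _ len(2)]
        dirichlet_poincare[OF A cA' A0(3,4) _ _ len(3)]
        split[of "\<lambda>x. (A x)\<^sup>2"] split[of "\<lambda>x. (A' x)\<^sup>2"]
      by (simp add: continuous_on_power cA cA' distrib_left)
  qed
  also have "\<dots> \<le> I (\<lambda>x. Q x * (A x)\<^sup>2)"
    unfolding grad mass
  proof (rule sum_mono)
    fix \<mu> assume "\<mu> \<in> T"
    then show "\<mu> * M \<mu> \<mu> \<le> M \<mu> \<mu>"
      using mult_right_mono[OF T(2) M_nonneg, of \<mu> \<mu>] by simp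
  qed
  finally have 1: "(14 / 10)\<^sup>2 * I (\<lambda>x. (A x)\<^sup>2) \<le> I (\<lambda>x. Q x * (A x)\<^sup>2)" .
  have 2: "I (\<lambda>x. Q x * (A x)\<^sup>2) \<le> I (\<lambda>x. 19 / 10 * (A x)\<^sup>2)"
    unfolding I_def
  proof (rule integral_le)
    show "(\<lambda>x. Q x * (A x)\<^sup>2) integrable_on {0..2 * pi}" "(\<lambda>x. 19 / 10 * (A x)\<^sup>2) integrable_on {0..2 * pi}"
      by (intro integrable_continuous_real continuous_intros cA cQ)+
    show "Q x * (A x)\<^sup>2 \<le> 19 / 10 * (A x)\<^sup>2" for x
      by (intro mult_right_mono Q_le zero_le_power2)
  qed
  have "I (\<lambda>x. 19 / 10 * (A x)\<^sup>2) = 19 / 10 * I (\<lambda>x. (A x)\<^sup>2)"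
    unfolding I_def by simp
  moreover have "(14 / 10)\<^sup>2 * I (\<lambda>x. (A x)\<^sup>2) = 196 / 100 * I (\<lambda>x. (A x)\<^sup>2)"
    by (simp add: power2_eq_square)
  ultimately have "I (\<lambda>x. Q x * (A x)\<^sup>2) \<le> 0"
    using 1 2 by linarith
  moreover have "0 \<le> (\<Sum>\<mu>\<in>T. M \<mu> \<mu>)"
    by (rule sum_nonneg) (rule M_nonneg)
  ultimately have "(\<Sum>\<mu>\<in>T. M \<mu> \<mu>) = 0"
    unfolding mass by linarith
  then have "M \<nu> \<nu> = 0"
    using \<nu> M_nonneg sum_nonneg_eq_0_iff[OF T(1), of "\<lambda>\<mu>. M \<mu> \<mu>"] by simp
  then have "Q x * (a \<nu> x * a \<nu> x) = 0"
    using Q_pos[THEN less_imp_le]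
    by (intro periodic_nonneg_integral_zero[where p = "2 * pi" and g = "\<lambda>x. Q x * (a \<nu> x * a \<nu> x)"])
      (auto intro!: continuous_intros ca cQ \<nu> simp: Q_per per \<nu> M_def I_def)
  then show ?thesis using Q_pos[of x] by auto
qed

text \<open>For \<open>f = a(x) + F(x) (b cos y + c sin y)\<close> the entries are twice the values of \<open>a\<close> at three
  equidistant points, and the coefficients \<open>b\<close> and \<open>c\<close> up to the factor \<open>2 F(0)\<close>.\<close>

definition probe :: "(real \<times> real \<Rightarrow> real) \<Rightarrow> real \<times> real \<times> real \<times> real \<times> real" where
  "probe f = (f (0, 0) + f (0, pi),
     f (2 * pi / 3, 0) + f (2 * pi / 3, pi),
     f (4 * pi / 3, 0) + f (4 * pi / 3, pi),
     f (0, 0) - f (0, pi),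
     f (0, pi / 2) - f (0, - pi / 2))"

text \<open>One statement serves two purposes: the probe is injective on each eigenspace with \<open>\<nu> \<le> 1\<close>,
  and the images of different eigenspaces form a direct sum in \<open>\<real>\<^sup>5\<close>.\<close>

lemma probe_injective:
  assumes T: "finite T" "\<And>\<nu>. \<nu> \<in> T \<Longrightarrow> \<nu> \<le> 1"
    and fs: "\<And>\<nu>. \<nu> \<in> T \<Longrightarrow> fs \<nu> \<in> eigenspace Q \<nu>"
    and zero: "(\<Sum>\<nu>\<in>T. probe (fs \<nu>)) = 0" and \<nu>: "\<nu> \<in> T"
  shows "fs \<nu> = 0"
proof -
  define S where "S \<nu> = (\<lambda>(a, a', b, c). (\<forall>x. (a has_field_derivative a' x) (at x)) \<and>
      (\<forall>x. (a' has_field_derivative - (\<nu> * Q x * a x)) (at x)) \<and>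
      (\<forall>x. a (x + 2 * pi) = a x) \<and>
      (\<forall>x y. fs \<nu> (x, y) = a x + F x * (b * cos y + c * sin y)) \<and>
      (\<nu> \<noteq> 1 \<longrightarrow> b = 0 \<and> c = 0))" for \<nu>
  have "\<exists>z. S \<nu> z" if mem: "\<nu> \<in> T" for \<nu>
  proof -
    obtain a a' b c where "S \<nu> (a, a', b, c)"
      unfolding S_def prod.case
      by (rule eigenspace_structure[OF fs[OF mem] T(2)[OF mem] Q_pos Q_cont F_pos F_per F_deriv F'_deriv])
        blast
    then show ?thesis ..
  qed
  then obtain z where z: "\<And>\<nu>. \<nu> \<in> T \<Longrightarrow> S \<nu> (z \<nu>)"
    by metis
  define a a' b c where "a \<nu> = fst (z \<nu>)" and "a' \<nu> = fst (snd (z \<nu>))"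
    and "b \<nu> = fst (snd (snd (z \<nu>)))" and "c \<nu> = snd (snd (snd (z \<nu>)))" for \<nu>
  have "S \<nu> (a \<nu>, a' \<nu>, b \<nu>, c \<nu>)" if "\<nu> \<in> T" for \<nu>
    using z[OF that] by (simp add: a_def a'_def b_def c_def)
  then have
    a: "\<And>\<nu> x. \<nu> \<in> T \<Longrightarrow> (a \<nu> has_field_derivative a' \<nu> x) (at x)"
      "\<And>\<nu> x. \<nu> \<in> T \<Longrightarrow> (a' \<nu> has_field_derivative - (\<nu> * Q x * a \<nu> x)) (at x)"
      "\<And>\<nu> x. \<nu> \<in> T \<Longrightarrow> a \<nu> (x + 2 * pi) = a \<nu> x"
    and f: "\<And>\<nu> x y. \<nu> \<in> T \<Longrightarrow> fs \<nu> (x, y) = a \<nu> x + F x * (b \<nu> * cos y + c \<nu> * sin y)"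
    and bc: "\<And>\<nu>. \<nu> \<in> T \<Longrightarrow> \<nu> \<noteq> 1 \<Longrightarrow> b \<nu> = 0 \<and> c \<nu> = 0"
    unfolding S_def prod.case by simp_all
  have "(\<Sum>\<nu>\<in>T. probe (fs \<nu>)) = (2 * (\<Sum>\<nu>\<in>T. a \<nu> 0), 2 * (\<Sum>\<nu>\<in>T. a \<nu> (2 * pi / 3)),
      2 * (\<Sum>\<nu>\<in>T. a \<nu> (4 * pi / 3)), 2 * F 0 * (\<Sum>\<nu>\<in>T. b \<nu>), 2 * F 0 * (\<Sum>\<nu>\<in>T. c \<nu>))"
    by (simp add: probe_def f prod_eq_iff fst_sum snd_sum sum_distrib_left cong: sum.cong)
      (simp add: algebra_simps)
  then have s0: "(\<Sum>\<nu>\<in>T. a \<nu> 0) = 0" "(\<Sum>\<nu>\<in>T. a \<nu> (2 * pi / 3)) = 0" "(\<Sum>\<nu>\<in>T. a \<nu> (4 * pi / 3)) = 0"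
    "(\<Sum>\<nu>\<in>T. b \<nu>) = 0" "(\<Sum>\<nu>\<in>T. c \<nu>) = 0"
    using zero F_pos[of 0] by (auto simp: zero_prod_def)
  have "a \<nu> x = 0" for x
    by (rule sturm_three_zeros[OF T a s0(1-3) \<nu>])
  moreover have "b \<nu> = 0 \<and> c \<nu> = 0"
  proof (cases "\<nu> = 1")
    case True
    then have "(\<Sum>\<nu>\<in>T. b \<nu>) = b 1" "(\<Sum>\<nu>\<in>T. c \<nu>) = c 1"
      using bc T(1) \<nu> by (simp_all add: sum.remove[of T 1 b] sum.remove[of T 1 c])
    then show ?thesis using s0 True by simp
  qed (use bc \<nu> in blast)
  ultimately show ?thesis using f[OF \<nu>] by auto
qed

end

section \<open>Linear structure of the eigenspaces\<close>

lemma partial_lincomb: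
  assumes "C_k (Suc k) f" "C_k (Suc k) g"
  shows "partial_x (\<lambda>p. f p + c * g p) = (\<lambda>p. partial_x f p + c * partial_x g p)"
    and "partial_y (\<lambda>p. f p + c * g p) = (\<lambda>p. partial_y f p + c * partial_y g p)"
proof -
  have dx: "((\<lambda>s. f (s, y)) has_field_derivative partial_x f (x, y)) (at x)"
    "((\<lambda>s. g (s, y)) has_field_derivative partial_x g (x, y)) (at x)"
    and dy: "((\<lambda>t. f (x, t)) has_field_derivative partial_y f (x, y)) (at y)"
    "((\<lambda>t. g (x, t)) has_field_derivative partial_y g (x, y)) (at y)" for x y
    using assms by (auto simp: partial_x_def partial_y_def DERIV_deriv_iff_real_differentiable)
  show "partial_x (\<lambda>p. f p + c * g p) = (\<lambda>p. partial_x f p + c * partial_x g p)"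
  proof
    fix p :: "real \<times> real"
    obtain x y where p: "p = (x, y)" by fastforce
    have "((\<lambda>s. f (s, y) + c * g (s, y)) has_field_derivative partial_x f (x, y) + c * partial_x g (x, y)) (at x)"
      by (intro DERIV_add DERIV_cmult dx)
    then have "deriv (\<lambda>s. f (s, y) + c * g (s, y)) x = partial_x f (x, y) + c * partial_x g (x, y)"
      by (rule DERIV_imp_deriv)
    then show "partial_x (\<lambda>p. f p + c * g p) p = partial_x f p + c * partial_x g p"
      unfolding p by (subst partial_x_def) simp
  qed
  show "partial_y (\<lambda>p. f p + c * g p) = (\<lambda>p. partial_y f p + c * partial_y g p)"
  proof
    fix p :: "real \<times> real"
    obtain x y where p: "p = (x, y)" by fastforce
    have "((\<lambda>t. f (x, t) + c * g (x, t)) has_field_derivative partial_y f (x, y) + c * partial_y g (x, y)) (at y)"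
      by (intro DERIV_add DERIV_cmult dy)
    then have "deriv (\<lambda>t. f (x, t) + c * g (x, t)) y = partial_y f (x, y) + c * partial_y g (x, y)"
      by (rule DERIV_imp_deriv)
    then show "partial_y (\<lambda>p. f p + c * g p) p = partial_y f p + c * partial_y g p"
      unfolding p by (subst partial_y_def) simp
  qed
qed

lemma C_k_lincomb:
  "C_k k f \<Longrightarrow> C_k k g \<Longrightarrow> C_k k (\<lambda>p. f p + c * g p)"
proof (induction k arbitrary: f g)
  case 0
  then show ?case by (auto intro!: continuous_intros)
next
  case (Suc k)
  have "(\<lambda>s. f (s, y) + c * g (s, y)) differentiable (at x)"
    "(\<lambda>t. f (x, t) + c * g (x, t)) differentiable (at y)" for x y
    using Suc.prems by (auto intro!: differentiable_add differentiable_mult)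
  then show ?case
    using Suc.prems Suc.IH unfolding C_k.simps(2) partial_lincomb[OF Suc.prems] by simp
qed

lemma eigenspace_lincomb:
  assumes f: "f \<in> eigenspace Q \<nu>" and g: "g \<in> eigenspace Q \<nu>"
  shows "(\<lambda>p. f p + c * g p) \<in> eigenspace Q \<nu>"
proof -
  have sm: "C_k k f" "C_k k g" for k
    using f g by (auto simp: eigenspace_def smooth_on_torus_def)
  note lin = partial_lincomb[OF sm(1) sm(2)]
  have sm2: "C_k k (partial_x f)" "C_k k (partial_x g)" "C_k k (partial_y f)" "C_k k (partial_y g)" for k
    using sm[of "Suc k"] by auto
  have L: "laplace_beltrami Q (\<lambda>p. f p + c * g p) p = laplace_beltrami Q f p + c * laplace_beltrami Q g p" for p
    unfolding laplace_beltrami_def lin partial_lincomb[OF sm2(1,2)] partial_lincomb[OF sm2(3,4)]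
    by (simp add: split_beta add_divide_distrib algebra_simps)
  have "- laplace_beltrami Q f p = \<nu> * f p" "- laplace_beltrami Q g p = \<nu> * g p" for p
    using f g unfolding eigenspace_def by blast+
  then have Lfg: "laplace_beltrami Q f p = - (\<nu> * f p)" "laplace_beltrami Q g p = - (\<nu> * g p)" for p
    by (metis minus_minus)+
  have "- laplace_beltrami Q (\<lambda>p. f p + c * g p) p = \<nu> * (f p + c * g p)" for p
    unfolding L Lfg by (simp add: algebra_simps)
  then show ?thesis
    using f g C_k_lincomb[of _ f g c] by (simp add: eigenspace_def smooth_on_torus_def)
qed

lemma zero_mem_eigenspace: "(\<lambda>_. 0) \<in> eigenspace Q \<nu>"
proof -
  have z: "partial_x (\<lambda>_. 0) = (\<lambda>_. 0)" "partial_y (\<lambda>_. 0) = (\<lambda>_. 0)"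
    by (auto simp: partial_x_def partial_y_def)
  have "C_k k (\<lambda>_. 0)" for k by (induction k) (auto simp: z)
  then show ?thesis by (simp add: eigenspace_def smooth_on_torus_def laplace_beltrami_def z case_prod_beta)
qed

lemma subspace_eigenspace: "fun_space.subspace (eigenspace Q \<nu>)"
  unfolding fun_space.subspace_def
proof (intro conjI ballI allI)
  show "0 \<in> eigenspace Q \<nu>" using zero_mem_eigenspace by (simp add: zero_fun_def)
  show "f + g \<in> eigenspace Q \<nu>" if "f \<in> eigenspace Q \<nu>" "g \<in> eigenspace Q \<nu>" for f g
    using eigenspace_lincomb[OF that, of 1] by (simp add: plus_fun_def)
  show "(\<lambda>p. c * f p) \<in> eigenspace Q \<nu>" if "f \<in> eigenspace Q \<nu>" for f c
    using eigenspace_lincomb[OF zero_mem_eigenspace that, of c] by simp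
qed

text \<open>By convention an infinite-dimensional subspace has dimension \<open>0\<close>. An injective linear map
  into \<open>\<real>\<^sup>5\<close> rules this case out, since it carries a basis to an independent set.\<close>

lemma dim_injective_image:
  fixes L :: "(real \<times> real \<Rightarrow> real) \<Rightarrow> real \<times> real \<times> real \<times> real \<times> real"
  assumes L: "Vector_Spaces.linear (\<lambda>c f p. c * f p) scaleR L"
    and S: "fun_space.subspace S" and inj: "inj_on L S"
  shows "dim (L ` S) = fun_space.dim S"
proof -
  interpret L: Vector_Spaces.linear "\<lambda>(c::real) (f::real \<times> real \<Rightarrow> real) p. c * f p" scaleR L
    by (rule L)
  obtain B where B: "B \<subseteq> S" "fun_space.independent B" "S \<subseteq> fun_space.span B" "card B = fun_space.dim S"
    using fun_space.basis_exists by blast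
  have span: "fun_space.span B = S"
    using fun_space.span_minimal[OF B(1) S] B(3) by blast
  have "independent (L ` B)"
    using L.independent_injective_image[OF B(2)] inj unfolding span by (simp add: dependent_raw_def)
  moreover have "L ` S \<subseteq> Real_Vector_Spaces.span (L ` B)"
    using L.span_image[of B] unfolding span by (simp add: span_raw_def)
  moreover have "card (L ` B) = fun_space.dim S"
    using card_image[OF inj_on_subset[OF inj B(1)]] B(4) by simp
  ultimately show ?thesis using B(1) by (intro dim_unique) auto
qed

section \<open>Counting the eigenvalues up to one\<close>

context liouville_ground_state begin

lemma linear_probe: "Vector_Spaces.linear (\<lambda>c f p. c * f p) scaleR probe"
  by unfold_locales (auto simp: probe_def algebra_simps)

lemma inj_on_probe: "\<nu> \<le> 1 \<Longrightarrow> inj_on probe (eigenspace Q \<nu>)"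
proof (rule inj_onI)
  fix f g assume \<nu>: "\<nu> \<le> 1" and fg: "f \<in> eigenspace Q \<nu>" "g \<in> eigenspace Q \<nu>" "probe f = probe g"
  have "(\<lambda>p. f p + (- 1) * g p) = 0"
    using probe_injective[of "{\<nu>}" "\<lambda>_. \<lambda>p. f p + (- 1) * g p" \<nu>] \<nu> eigenspace_lincomb[OF fg(1,2), of "- 1"] fg(3)
    by (auto simp: probe_def zero_prod_def)
  then show "f = g" by (auto simp: fun_eq_iff)
qed

lemma dim_probe_eigenspace:
  "\<nu> \<le> 1 \<Longrightarrow> dim (probe ` eigenspace Q \<nu>) = eigenvalue_mult Q \<nu>"
  unfolding eigenvalue_mult_def
  by (rule dim_injective_image[OF linear_probe subspace_eigenspace inj_on_probe])

lemma subspace_probe_eigenspace: "subspace (probe ` eigenspace Q \<nu>)"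
proof -
  interpret L: Vector_Spaces.linear "\<lambda>(c::real) (f::real \<times> real \<Rightarrow> real) p. c * f p" scaleR probe
    by (rule linear_probe)
  show ?thesis using L.subspace_image[OF subspace_eigenspace] by (simp add: subspace_raw_def)
qed

text \<open>The dimension of a direct sum inside \<open>\<real>\<^sup>5\<close> is at most \<open>5\<close>; the induction adjoins the images of
  the eigenspaces one by one.\<close>

lemma sum_mult_le_5:
  assumes "finite T" "\<And>\<nu>. \<nu> \<in> T \<Longrightarrow> \<nu> \<le> 1"
  shows "(\<Sum>\<nu>\<in>T. eigenvalue_mult Q \<nu>) \<le> 5"
proof -
  define U where "U T = {\<Sum>\<nu>\<in>T. probe (fs \<nu>) | fs. \<forall>\<nu>\<in>T. fs \<nu> \<in> eigenspace Q \<nu>}" for T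
  have "subspace (U T) \<and> dim (U T) = (\<Sum>\<nu>\<in>T. eigenvalue_mult Q \<nu>)"
    using assms
  proof (induction T rule: finite_induct)
    case empty
    have "U {} = {0}" by (auto simp: U_def)
    then show ?case by simp
  next
    case (insert \<mu> T)
    let ?E = "probe ` eigenspace Q \<mu>"
    have IH: "subspace (U T)" "dim (U T) = (\<Sum>\<nu>\<in>T. eigenvalue_mult Q \<nu>)"
      using insert by auto
    have eq: "U (insert \<mu> T) = {x + y |x y. x \<in> ?E \<and> y \<in> U T}"
    proof (intro equalityI subsetI)
      fix v assume "v \<in> U (insert \<mu> T)"
      then obtain fs where fs: "v = (\<Sum>\<nu>\<in>insert \<mu> T. probe (fs \<nu>))"
        "\<forall>\<nu>\<in>insert \<mu> T. fs \<nu> \<in> eigenspace Q \<nu>"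
        unfolding U_def by blast
      then have "v = probe (fs \<mu>) + (\<Sum>\<nu>\<in>T. probe (fs \<nu>))"
        using insert(1,2) by simp
      moreover have "probe (fs \<mu>) \<in> ?E" "(\<Sum>\<nu>\<in>T. probe (fs \<nu>)) \<in> U T"
        using fs(2) unfolding U_def by blast+
      ultimately show "v \<in> {x + y |x y. x \<in> ?E \<and> y \<in> U T}"
        by blast
    next
      fix v assume "v \<in> {x + y |x y. x \<in> ?E \<and> y \<in> U T}"
      then obtain f fs where v: "v = probe f + (\<Sum>\<nu>\<in>T. probe (fs \<nu>))" "f \<in> eigenspace Q \<mu>"
        "\<forall>\<nu>\<in>T. fs \<nu> \<in> eigenspace Q \<nu>"
        unfolding U_def by blast
      define gs where "gs = fs(\<mu> := f)"
      have "(\<Sum>\<nu>\<in>T. probe (fs \<nu>)) = (\<Sum>\<nu>\<in>T. probe (gs \<nu>))"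
        using insert(2) by (intro sum.cong) (auto simp: gs_def)
      then have "v = (\<Sum>\<nu>\<in>insert \<mu> T. probe (gs \<nu>))"
        using v(1) insert(1,2) by (simp add: gs_def)
      moreover have "\<forall>\<nu>\<in>insert \<mu> T. gs \<nu> \<in> eigenspace Q \<nu>"
        using v(2,3) by (simp add: gs_def)
      ultimately show "v \<in> U (insert \<mu> T)"
        unfolding U_def by blast
    qed
    have "?E \<inter> U T \<subseteq> {0}"
    proof
      fix v assume "v \<in> ?E \<inter> U T"
      then obtain f fs where v: "v = probe f" "v = (\<Sum>\<nu>\<in>T. probe (fs \<nu>))" "f \<in> eigenspace Q \<mu>"
        "\<forall>\<nu>\<in>T. fs \<nu> \<in> eigenspace Q \<nu>"
        unfolding U_def by blast
      define gs where "gs = fs(\<mu> := \<lambda>p. 0 + (- 1) * f p)"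
      have "(\<Sum>\<nu>\<in>T. probe (fs \<nu>)) = (\<Sum>\<nu>\<in>T. probe (gs \<nu>))"
        using insert(2) by (intro sum.cong) (auto simp: gs_def)
      moreover have "probe (gs \<mu>) = - probe f"
        by (simp add: gs_def probe_def)
      ultimately have "(\<Sum>\<nu>\<in>insert \<mu> T. probe (gs \<nu>)) = 0"
        using v(1,2) insert(1,2) by simp
      moreover have "\<forall>\<nu>\<in>insert \<mu> T. gs \<nu> \<in> eigenspace Q \<nu>"
        using v(3,4) eigenspace_lincomb[OF zero_mem_eigenspace v(3), of "- 1"] by (simp add: gs_def)
      ultimately have "gs \<mu> = 0"
        using insert(1,4) by (intro probe_injective[of "insert \<mu> T" gs]) auto
      then have "f = (\<lambda>_. 0)" by (auto simp: gs_def fun_eq_iff)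
      then show "v \<in> {0}" using v(1) by (simp add: probe_def zero_prod_def)
    qed
    then have "dim (?E \<inter> U T) = 0"
      by (simp only: dim_eq_0)
    then have dim_sum: "dim {x + y |x y. x \<in> ?E \<and> y \<in> U T} = dim ?E + dim (U T)"
      using dim_sums_Int[OF subspace_probe_eigenspace IH(1), of \<mu>] by linarith
    have dim_E: "dim ?E = eigenvalue_mult Q \<mu>"
      using insert(4) by (intro dim_probe_eigenspace) simp
    show ?case
      unfolding eq sum.insert[OF insert(1,2)] dim_sum dim_E IH(2)
      using subspace_sums[OF subspace_probe_eigenspace IH(1)] by blast
  qed
  then show ?thesis
    using dim_subset_UNIV[of "U T"] by simp
qed

text \<open>Six eigenvalues would violate the bound above. The eigenvalue count is a sum over sets of this kind
  and would collapse to \<open>0\<close> over an infinite one.\<close>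

lemma finite_eigenvalues_le_1: "finite {\<nu>. \<nu> \<le> 1 \<and> eigenvalue_mult Q \<nu> > 0}"
proof (rule ccontr)
  assume "infinite {\<nu>. \<nu> \<le> 1 \<and> eigenvalue_mult Q \<nu> > 0}"
  then obtain T where T: "T \<subseteq> {\<nu>. \<nu> \<le> 1 \<and> eigenvalue_mult Q \<nu> > 0}" "finite T" "card T = 6"
    using infinite_arbitrarily_large by blast
  have "card T = (\<Sum>\<nu>\<in>T. 1)" by simp
  also have "\<dots> \<le> (\<Sum>\<nu>\<in>T. eigenvalue_mult Q \<nu>)"
    using T(1) by (intro sum_mono) (auto simp: Suc_le_eq)
  also have "\<dots> \<le> 5"
    using T by (intro sum_mult_le_5) auto
  finally show False using T(3) by simp
qed

end

text \<open>The count is a step function of its argument with finitely many steps up to \<open>\<mu>\<close>. It first exceeds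
  the number of eigenvalues below \<open>\<mu>\<close> at \<open>\<mu>\<close> itself. For smaller indices the least admissible
  argument is attained, at an eigenvalue below \<open>\<mu>\<close>; this has to be checked since the reals are not
  well ordered.\<close>

lemma first_index_of_eigenvalue:
  assumes fin: "finite {\<nu>. \<nu> \<le> \<mu> \<and> eigenvalue_mult Q \<nu> > 0}"
    and pos: "eigenvalue_mult Q \<mu> > 0"
  shows "is_kth_eigenvalue Q (Suc (\<Sum>\<nu> | \<nu> < \<mu> \<and> eigenvalue_mult Q \<nu> > 0. eigenvalue_mult Q \<nu>)) \<mu>"
proof -
  define S where "S t = {\<nu>. \<nu> \<le> t \<and> eigenvalue_mult Q \<nu> > 0}" for t
  define B where "B = {\<nu>. \<nu> < \<mu> \<and> eigenvalue_mult Q \<nu> > 0}"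
  define c where "c = (\<Sum>\<nu>\<in>B. eigenvalue_mult Q \<nu>)"
  have count: "eigenvalue_count Q t = sum (eigenvalue_mult Q) (S t)" for t
    by (simp add: eigenvalue_count_def S_def)
  have finB: "finite B" by (rule finite_subset[OF _ fin]) (auto simp: B_def)
  have "S \<mu> = insert \<mu> B" using pos by (auto simp: S_def B_def)
  then have count_\<mu>: "eigenvalue_count Q \<mu> = eigenvalue_mult Q \<mu> + c"
    using finB by (simp add: count c_def B_def)
  have below: "eigenvalue_count Q t \<le> c" if "t < \<mu>" for t
    unfolding count c_def by (rule sum_mono2[OF finB]) (use that in \<open>auto simp: S_def B_def\<close>)
  have least: "liouville_eigenvalue Q (Suc c) = \<mu>"
    unfolding liouville_eigenvalue_def
  proof (rule Least_equality)
    show "Suc c \<le> eigenvalue_count Q \<mu>" using count_\<mu> pos by simp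
    show "\<mu> \<le> t" if "Suc c \<le> eigenvalue_count Q t" for t
      using below[of t] that by force
  qed
  have small: "liouville_eigenvalue Q j < \<mu>" if j: "1 \<le> j" "j < Suc c" for j
  proof -
    define D where "D = {\<nu> \<in> B. j \<le> eigenvalue_count Q \<nu>}"
    have "finite D" using finB by (simp add: D_def)
    have "B \<noteq> {}" using j by (auto simp: c_def)
    have "S (Max B) = B"
      using Max_ge[OF finB] Max_in[OF finB \<open>B \<noteq> {}\<close>] by (auto simp: S_def B_def)
    then have "Max B \<in> D"
      using j Max_in[OF finB \<open>B \<noteq> {}\<close>] by (simp add: D_def count c_def)
    then have "D \<noteq> {}" by blast
    have minD: "Min D \<in> D" using Min_in[OF \<open>finite D\<close> \<open>D \<noteq> {}\<close>] .
    have "Min D \<le> t" if t: "j \<le> eigenvalue_count Q t" for t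
    proof (cases "t < \<mu>")
      case True
      have "S t \<subseteq> B" using True by (auto simp: S_def B_def)
      then have finS: "finite (S t)" using finB finite_subset by blast
      have "S t \<noteq> {}" using t j by (auto simp: count)
      have "S (Max (S t)) = S t"
        using Max_ge[OF finS] Max_in[OF finS \<open>S t \<noteq> {}\<close>] by (force simp: S_def)
      then have "Max (S t) \<in> D"
        using t Max_in[OF finS \<open>S t \<noteq> {}\<close>] \<open>S t \<subseteq> B\<close> by (auto simp: D_def count)
      then have "Min D \<le> Max (S t)" using \<open>finite D\<close> by simp
      then show ?thesis using Max_in[OF finS \<open>S t \<noteq> {}\<close>] by (auto simp: S_def)
    next
      case False
      then show ?thesis using minD by (auto simp: D_def B_def)
    qed
    then have "liouville_eigenvalue Q j = Min D"
      unfolding liouville_eigenvalue_def using minD by (intro Least_equality) (auto simp: D_def)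
    then show ?thesis using minD by (auto simp: D_def B_def)
  qed
  show ?thesis
    unfolding is_kth_eigenvalue_def B_def[symmetric] c_def[symmetric]
    using least small by fastforce
qed

context liouville_ground_state begin

lemma eigenvalue_mult_1_ge_2:
  assumes "(\<lambda>(x, y). F x * cos y) \<in> eigenspace Q 1" "(\<lambda>(x, y). F x * sin y) \<in> eigenspace Q 1"
  shows "eigenvalue_mult Q 1 \<ge> 2"
proof -
  define u v where "u = probe (\<lambda>(x, y). F x * cos y)" and "v = probe (\<lambda>(x, y). F x * sin y)"
  have uv: "u = (0, 0, 0, 2 * F 0, 0)" "v = (0, 0, 0, 0, 2 * F 0)"
    by (simp_all add: u_def v_def probe_def)
  have "u \<noteq> v" using F_pos[of 0] by (simp add: uv)
  have "independent {u, v}"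
    by (rule pairwise_orthogonal_independent)
      (use F_pos[of 0] in \<open>auto simp: uv pairwise_def orthogonal_def inner_prod_def zero_prod_def\<close>)
  moreover have "{u, v} \<subseteq> probe ` eigenspace Q 1"
    using assms by (auto simp: u_def v_def)
  ultimately have "card {u, v} \<le> dim (probe ` eigenspace Q 1)"
    by (intro independent_card_le_dim)
  then show ?thesis using \<open>u \<noteq> v\<close> dim_probe_eigenspace[of 1] by simp
qed

lemma eigenvalue_mult_0_ge_1:
  assumes "(\<lambda>_. 1) \<in> eigenspace Q 0"
  shows "eigenvalue_mult Q 0 \<ge> 1"
proof -
  have "probe (\<lambda>_. 1) \<in> probe ` eigenspace Q 0" using assms by blast
  moreover have "probe (\<lambda>_. 1) \<noteq> 0" by (simp add: probe_def zero_prod_def)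
  ultimately have "dim (probe ` eigenspace Q 0) \<noteq> 0" by (auto simp: dim_eq_0)
  then show ?thesis using dim_probe_eigenspace[of 0] by simp
qed

text \<open>The constants give at least one eigenvalue below \<open>1\<close>, at most five eigenvalues are \<open>\<le> 1\<close>, and at
  least two of these equal \<open>1\<close>. So between one and three of them precede the eigenvalue \<open>1\<close>.\<close>

lemma index_of_eigenvalue_1:
  assumes E1: "(\<lambda>(x, y). F x * cos y) \<in> eigenspace Q 1" "(\<lambda>(x, y). F x * sin y) \<in> eigenspace Q 1"
    and E0: "(\<lambda>_. 1) \<in> eigenspace Q 0"
  shows "\<exists>k\<in>{2, 3, 4}. is_kth_eigenvalue Q k 1"
proof -
  let ?B = "{\<nu>. \<nu> < 1 \<and> eigenvalue_mult Q \<nu> > 0}"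
  let ?c = "\<Sum>\<nu>\<in>?B. eigenvalue_mult Q \<nu>"
  have m1: "eigenvalue_mult Q 1 \<ge> 2" by (rule eigenvalue_mult_1_ge_2[OF E1])
  have m0: "eigenvalue_mult Q 0 \<ge> 1" by (rule eigenvalue_mult_0_ge_1[OF E0])
  have fin: "finite ?B" by (rule finite_subset[OF _ finite_eigenvalues_le_1]) auto
  have "eigenvalue_mult Q 0 \<le> ?c"
    by (rule member_le_sum) (use fin m0 in auto)
  moreover have "?c + eigenvalue_mult Q 1 \<le> 5"
  proof -
    have "(\<Sum>\<nu>\<in>insert 1 ?B. eigenvalue_mult Q \<nu>) = eigenvalue_mult Q 1 + ?c"
      using fin by (intro sum.insert) auto
    moreover have "(\<Sum>\<nu>\<in>insert 1 ?B. eigenvalue_mult Q \<nu>) \<le> 5"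
      by (rule sum_mult_le_5) (use fin in auto)
    ultimately show ?thesis by linarith
  qed
  ultimately have "Suc ?c \<in> {2, 3, 4}" using m0 m1 by auto
  moreover have "is_kth_eigenvalue Q (Suc ?c) 1"
    by (rule first_index_of_eigenvalue[OF finite_eigenvalues_le_1]) (use m1 in simp)
  ultimately show ?thesis by blast
qed

end

section \<open>Smooth eigenfunctions of product form\<close>

text \<open>An algebra of functions that contains the eigenfunctions in question and is closed under both partial
  derivatives, which makes its members smooth.\<close>

inductive trig_exp :: "real \<Rightarrow> real \<Rightarrow> (real \<times> real \<Rightarrow> real) \<Rightarrow> bool" for \<epsilon> \<kappa> where
  const: "trig_exp \<epsilon> \<kappa> (\<lambda>_. c)"
| cos_x: "trig_exp \<epsilon> \<kappa> (\<lambda>p. cos (\<kappa> * fst p))"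
| sin_x: "trig_exp \<epsilon> \<kappa> (\<lambda>p. sin (\<kappa> * fst p))"
| cos_y: "trig_exp \<epsilon> \<kappa> (\<lambda>p. cos (snd p))"
| sin_y: "trig_exp \<epsilon> \<kappa> (\<lambda>p. sin (snd p))"
| exp_cos: "trig_exp \<epsilon> \<kappa> (\<lambda>p. exp (\<epsilon> * cos (\<kappa> * fst p)))"
| add: "trig_exp \<epsilon> \<kappa> f \<Longrightarrow> trig_exp \<epsilon> \<kappa> g \<Longrightarrow> trig_exp \<epsilon> \<kappa> (\<lambda>p. f p + g p)"
| mult: "trig_exp \<epsilon> \<kappa> f \<Longrightarrow> trig_exp \<epsilon> \<kappa> g \<Longrightarrow> trig_exp \<epsilon> \<kappa> (\<lambda>p. f p * g p)"

lemma trig_exp_cmult: "trig_exp \<epsilon> \<kappa> f \<Longrightarrow> trig_exp \<epsilon> \<kappa> (\<lambda>p. c * f p)"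
  using trig_exp.mult[OF trig_exp.const] .

lemma trig_exp_continuous: "trig_exp \<epsilon> \<kappa> f \<Longrightarrow> continuous_on UNIV f"
  by (induction rule: trig_exp.induct) (auto intro!: continuous_intros)

lemma trig_exp_partial:
  assumes "trig_exp \<epsilon> \<kappa> f"
  shows "\<exists>fx fy. trig_exp \<epsilon> \<kappa> fx \<and> trig_exp \<epsilon> \<kappa> fy \<and>
    (\<forall>x y. ((\<lambda>s. f (s, y)) has_field_derivative fx (x, y)) (at x) \<and>
           ((\<lambda>t. f (x, t)) has_field_derivative fy (x, y)) (at y))"
  using assms
proof induction
  case (const c)
  show ?case
    by (intro exI[of _ "\<lambda>_. 0"] conjI allI trig_exp.const) auto
next
  case cos_x
  show ?case
    by (intro exI[of _ "\<lambda>p. - \<kappa> * sin (\<kappa> * fst p)"] exI[of _ "\<lambda>_. 0"] conjI allI trig_exp.const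
        trig_exp_cmult trig_exp.sin_x) (auto intro!: derivative_eq_intros)
next
  case sin_x
  show ?case
    by (intro exI[of _ "\<lambda>p. \<kappa> * cos (\<kappa> * fst p)"] exI[of _ "\<lambda>_. 0"] conjI allI trig_exp.const
        trig_exp_cmult trig_exp.cos_x) (auto intro!: derivative_eq_intros)
next
  case cos_y
  show ?case
    by (intro exI[of _ "\<lambda>_. 0"] exI[of _ "\<lambda>p. - 1 * sin (snd p)"] conjI allI trig_exp.const
        trig_exp_cmult trig_exp.sin_y) (auto intro!: derivative_eq_intros)
next
  case sin_y
  show ?case
    by (intro exI[of _ "\<lambda>_. 0"] exI[of _ "\<lambda>p. cos (snd p)"] conjI allI trig_exp.const
        trig_exp.cos_y) (auto intro!: derivative_eq_intros)
next
  case exp_cos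
  show ?case
    by (intro exI[of _ "\<lambda>p. - (\<epsilon> * \<kappa>) * (sin (\<kappa> * fst p) * exp (\<epsilon> * cos (\<kappa> * fst p)))"]
        exI[of _ "\<lambda>_. 0"] conjI allI trig_exp.const trig_exp_cmult trig_exp.mult trig_exp.sin_x trig_exp.exp_cos)
      (auto intro!: derivative_eq_intros)
next
  case (add f g)
  then obtain fx fy gx gy where d: "trig_exp \<epsilon> \<kappa> fx" "trig_exp \<epsilon> \<kappa> fy" "trig_exp \<epsilon> \<kappa> gx" "trig_exp \<epsilon> \<kappa> gy"
    "\<And>x y. ((\<lambda>s. f (s, y)) has_field_derivative fx (x, y)) (at x)"
    "\<And>x y. ((\<lambda>t. f (x, t)) has_field_derivative fy (x, y)) (at y)"
    "\<And>x y. ((\<lambda>s. g (s, y)) has_field_derivative gx (x, y)) (at x)"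
    "\<And>x y. ((\<lambda>t. g (x, t)) has_field_derivative gy (x, y)) (at y)" by blast
  show ?case
    by (intro exI[of _ "\<lambda>p. fx p + gx p"] exI[of _ "\<lambda>p. fy p + gy p"] conjI allI
        trig_exp.add DERIV_add d)
next
  case (mult f g)
  then obtain fx fy gx gy where d: "trig_exp \<epsilon> \<kappa> fx" "trig_exp \<epsilon> \<kappa> fy" "trig_exp \<epsilon> \<kappa> gx" "trig_exp \<epsilon> \<kappa> gy"
    "\<And>x y. ((\<lambda>s. f (s, y)) has_field_derivative fx (x, y)) (at x)"
    "\<And>x y. ((\<lambda>t. f (x, t)) has_field_derivative fy (x, y)) (at y)"
    "\<And>x y. ((\<lambda>s. g (s, y)) has_field_derivative gx (x, y)) (at x)"
    "\<And>x y. ((\<lambda>t. g (x, t)) has_field_derivative gy (x, y)) (at y)" by blast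
  show ?case
    by (intro exI[of _ "\<lambda>p. fx p * g p + gx p * f p"] exI[of _ "\<lambda>p. fy p * g p + gy p * f p"] conjI allI
        trig_exp.add trig_exp.mult DERIV_mult d mult.hyps)
qed

lemma partial_eqI:
  "(\<And>x y. ((\<lambda>s. f (s, y)) has_field_derivative fx (x, y)) (at x)) \<Longrightarrow> partial_x f = fx"
  "(\<And>x y. ((\<lambda>t. f (x, t)) has_field_derivative fy (x, y)) (at y)) \<Longrightarrow> partial_y f = fy"
  unfolding partial_x_def partial_y_def by (auto simp: fun_eq_iff intro!: DERIV_imp_deriv)

lemma trig_exp_C_k: "trig_exp \<epsilon> \<kappa> f \<Longrightarrow> C_k k f"
proof (induction k arbitrary: f)
  case 0
  then show ?case by (simp add: trig_exp_continuous)
next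
  case (Suc k)
  obtain fx fy where d: "trig_exp \<epsilon> \<kappa> fx" "trig_exp \<epsilon> \<kappa> fy"
    "\<And>x y. ((\<lambda>s. f (s, y)) has_field_derivative fx (x, y)) (at x)"
    "\<And>x y. ((\<lambda>t. f (x, t)) has_field_derivative fy (x, y)) (at y)"
    using trig_exp_partial[OF Suc.prems] by blast
  have "partial_x f = fx" "partial_y f = fy" by (rule partial_eqI, rule d)+
  moreover have "(\<lambda>s. f (s, y)) differentiable (at x)" "(\<lambda>t. f (x, t)) differentiable (at y)" for x y
    using d(3)[of y x] d(4)[of x y] real_differentiable_def by blast+
  ultimately show ?case
    using Suc.IH[OF d(1)] Suc.IH[OF d(2)] by simp
qed

lemma const_mem_eigenspace_0: "(\<lambda>_. 1) \<in> eigenspace Q 0"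
proof -
  have z: "partial_x (\<lambda>_. c) = (\<lambda>_. 0)" "partial_y (\<lambda>_. c) = (\<lambda>_. 0)" for c
    by (rule partial_eqI, simp)+
  show ?thesis
    using trig_exp_C_k[OF trig_exp.const[of 0 0 1]]
    by (simp add: eigenspace_def smooth_on_torus_def laplace_beltrami_def z case_prod_beta)
qed

lemma product_mem_eigenspace_1:
  assumes sm: "\<And>k. C_k k (\<lambda>(x, y). F x * u y)"
    and per: "\<And>x. F (x + 2 * pi) = F x" "\<And>y. u (y + 2 * pi) = u y"
    and F: "\<And>x. (F has_field_derivative F' x) (at x)"
      "\<And>x. (F' has_field_derivative (1 - Q x) * F x) (at x)"
    and u: "\<And>y. (u has_field_derivative u' y) (at y)"
      "\<And>y. (u' has_field_derivative - u y) (at y)"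
    and Q: "\<And>x. Q x > (0::real)"
  shows "(\<lambda>(x, y). F x * u y) \<in> eigenspace Q 1"
proof -
  have "partial_x (\<lambda>(x, y). F x * u y) = (\<lambda>(x, y). F' x * u y)"
    "partial_x (\<lambda>(x, y). F' x * u y) = (\<lambda>(x, y). (1 - Q x) * F x * u y)"
    by (rule partial_eqI, simp, rule DERIV_cmult_right, rule F)+
  moreover have "partial_y (\<lambda>(x, y). F x * u y) = (\<lambda>(x, y). F x * u' y)"
    "partial_y (\<lambda>(x, y). F x * u' y) = (\<lambda>(x, y). F x * - u y)"
    by (rule partial_eqI, simp only: prod.case, rule DERIV_cmult, rule u)+
  ultimately have "laplace_beltrami Q (\<lambda>(x, y). F x * u y) (x, y) = - (F x * u y)" for x y
    using Q[of x] by (simp add: laplace_beltrami_def field_simps)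
  then show ?thesis
    using sm per by (auto simp: eigenspace_def smooth_on_torus_def)
qed

section \<open>Components of the super-level set\<close>

text \<open>On the super-level set \<open>F(x) > 1\<close>, as \<open>cos y \<le> 1\<close>; for \<open>z = cis x\<close> this says
  \<open>Re (z\<^sup>k) > 0\<close>. There the principal \<open>k\<close>-th root of \<open>z\<^sup>k\<close> is continuous, and the quotient of \<open>z\<close> by it is a continuous function with values in the \<open>k\<close>-th roots of unity, hence constant on connected
  sets. It takes a different value at each point \<open>(\<omega>, 1)\<close> with \<open>\<omega>\<close> a \<open>k\<close>-th root of unity.\<close>

lemma superlevel_components_product:
  fixes F :: "real \<Rightarrow> real" and k :: nat
  assumes k: "k \<ge> 1"
    and F: "\<And>x. F x > 0" "\<And>x. F x > 1 \<longleftrightarrow> cos (real k * x) > 0"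
  shows "\<exists>C \<subseteq> superlevel_components (\<lambda>(x, y). F x * cos y) 1. finite C \<and> card C = k"
proof -
  define S where "S = torus_proj ` {p. (\<lambda>(x, y). F x * cos y) p > 1}"
  define \<omega> where "\<omega> j = cis (2 * pi * real j / real k)" for j
  define P where "P j = (\<omega> j, 1 :: complex)" for j :: nat
  have \<omega>k: "\<omega> j ^ k = 1" for j
  proof -
    have "\<omega> j ^ k = cis (real k * (2 * pi * real j / real k))" by (simp only: \<omega>_def Complex.DeMoivre)
    also have "\<dots> = cis (2 * pi * real j)" using k by simp
    also have "\<dots> = 1" by (rule cis_multiple_2pi) simp
    finally show ?thesis .
  qed
  have P_mem: "P j \<in> S" for j
  proof -
    let ?x = "2 * pi * real j / real k"
    have "real k * ?x = 2 * pi * real j" using k by simp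
    then have "cos (real k * ?x) = 1" using cos_int_2pin[of "int j"] by (simp add: mult.commute mult.left_commute)
    then have "F ?x > 1" using F(2) by simp
    then have "(?x, 0) \<in> {p. (\<lambda>(x, y). F x * cos y) p > 1}" by simp
    moreover have "torus_proj (?x, 0) = P j" by (simp add: torus_proj_def P_def \<omega>_def)
    ultimately show ?thesis unfolding S_def by (metis imageI)
  qed
  have S_Re: "Re (fst q ^ k) > 0 \<and> fst q \<noteq> 0" if q_mem: "q \<in> S" for q
  proof -
    obtain x y where q: "q = (cis x, cis y)" and gt: "F x * cos y > 1"
      using q_mem by (auto simp: S_def torus_proj_def)
    have "F x * cos y \<le> F x" using F(1)[of x] by (simp add: mult_left_le)
    then have "cos (real k * x) > 0" using gt F(2)[of x] by linarith
    then show ?thesis by (simp add: q Complex.DeMoivre)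
  qed
  define \<phi> where "\<phi> q = fst q / exp (Ln (fst q ^ k) / of_nat k)" for q :: "complex \<times> complex"
  have cont: "continuous_on S \<phi>"
  proof -
    have "fst q ^ k \<notin> \<real>\<^sub>\<le>\<^sub>0" if "q \<in> S" for q
      using S_Re[OF that] by (auto simp: complex_nonpos_Reals_iff)
    then show ?thesis unfolding \<phi>_def
      by (intro continuous_intros) (use k in auto)
  qed
  have pow: "\<phi> q ^ k = 1" if "q \<in> S" for q
  proof -
    have "exp (Ln (fst q ^ k) / of_nat k) ^ k = exp (of_nat k * (Ln (fst q ^ k) / of_nat k))"
      by (simp only: exp_of_nat_mult)
    also have "\<dots> = fst q ^ k" using k S_Re[OF that] by simp
    finally show ?thesis using S_Re[OF that] by (simp add: \<phi>_def power_divide)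
  qed
  have \<phi>P: "\<phi> (P j) = \<omega> j" for j
    by (simp add: \<phi>_def P_def \<omega>k)
  define comp where "comp j = connected_component_set S (P j)" for j
  have inj: "inj_on comp {..<k}"
  proof (rule inj_onI)
    fix i j assume ij: "i \<in> {..<k}" "j \<in> {..<k}" "comp i = comp j"
    have mem: "P i \<in> comp i" "P j \<in> comp i"
      using P_mem ij(3) by (auto simp: comp_def connected_component_refl)
    have sub: "comp i \<subseteq> S" unfolding comp_def by (rule connected_component_subset)
    have "\<phi> constant_on comp i"
    proof (rule continuous_finite_range_constant)
      show "connected (comp i)" by (simp add: comp_def)
      show "continuous_on (comp i) \<phi>" by (rule continuous_on_subset[OF cont sub])
      have "\<phi> ` comp i \<subseteq> {z. z ^ k = 1}" using pow sub by auto
      then show "finite (\<phi> ` comp i)"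
        using finite_roots_unity[OF k] finite_subset by blast
    qed
    then have "\<omega> i = \<omega> j" using mem \<phi>P unfolding constant_on_def by metis
    then show "i = j"
      using Complex.bij_betw_roots_unity[of k] k ij(1,2) unfolding bij_betw_def inj_on_def \<omega>_def by auto
  qed
  have "comp ` {..<k} \<subseteq> superlevel_components (\<lambda>(x, y). F x * cos y) 1"
    using P_mem unfolding superlevel_components_def S_def[symmetric]
    by (auto simp: components_def comp_def)
  moreover have "card (comp ` {..<k}) = k" using card_image[OF inj] by simp
  ultimately show ?thesis by (intro exI[of _ "comp ` {..<k}"]) auto
qed

section \<open>Trigonometric conformal factors\<close>

text \<open>The conformal factor of the example is of this form; each derivative advances the phases by
  \<open>\<pi> / 2\<close>.\<close>

lemma higher_deriv_two_cosines:
  "(deriv ^^ j) (\<lambda>x::real. a * cos (\<alpha> * x) + b * cos (\<beta> * x) + c) =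
    (\<lambda>x. a * \<alpha> ^ j * cos (\<alpha> * x + real j * (pi / 2)) + b * \<beta> ^ j * cos (\<beta> * x + real j * (pi / 2))
        + (if j = 0 then c else 0))"
proof (induction j)
  case 0
  then show ?case by simp
next
  case (Suc j)
  have shift: "cos (t + real (Suc j) * (pi / 2)) = - sin (t + real j * (pi / 2))" for t
  proof -
    have "t + real (Suc j) * (pi / 2) = (t + real j * (pi / 2)) + pi / 2"
      by (simp add: algebra_simps add_divide_distrib)
    then show ?thesis by (simp only: cos_add cos_pi_half sin_pi_half)
  qed
  show ?case
    unfolding funpow.simps comp_def Suc.IH shift
    by (rule ext, rule DERIV_imp_deriv) (auto intro!: derivative_eq_intros)
qed

lemma real_analytic_two_cosines:
  "real_analytic (\<lambda>x::real. a * cos (\<alpha> * x) + b * cos (\<beta> * x) + c)"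
  unfolding real_analytic_def
proof
  fix x0 :: real
  have "\<exists>G. (\<lambda>t. a * (cos (\<alpha> * x0) * cos (\<alpha> * t) - sin (\<alpha> * x0) * sin (\<alpha> * t))
      + b * (cos (\<beta> * x0) * cos (\<beta> * t) - sin (\<beta> * x0) * sin (\<beta> * t)) + c) has_fps_expansion G"
    by (rule exI[of _ "fps_const a * (fps_const (cos (\<alpha> * x0)) * fps_cos \<alpha> - fps_const (sin (\<alpha> * x0)) * fps_sin \<alpha>)
        + fps_const b * (fps_const (cos (\<beta> * x0)) * fps_cos \<beta> - fps_const (sin (\<beta> * x0)) * fps_sin \<beta>)
        + fps_const c"])
      (intro has_fps_expansion_add has_fps_expansion_diff has_fps_expansion_cmult_left
        has_fps_expansion_cos has_fps_expansion_sin has_fps_expansion_const)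
  then show "\<exists>G. (\<lambda>t. a * cos (\<alpha> * (x0 + t)) + b * cos (\<beta> * (x0 + t)) + c) has_fps_expansion G"
    by (simp only: distrib_left[of _ x0] cos_add)
qed

section \<open>The perturbed metrics\<close>

lemma exp_cos_gt_1_iff:
  fixes \<epsilon> :: real
  assumes "\<epsilon> > 0"
  shows "exp (\<epsilon> * c) > 1 \<longleftrightarrow> c > 0"
  using assms by (simp add: zero_less_mult_iff)

text \<open>With \<open>F = exp (\<epsilon> cos (\<kappa> x))\<close> the ground state equation forces
  \<open>Q = 1 - F'' / F = 1 + \<epsilon> \<kappa>\<^sup>2 cos (\<kappa> x) - \<epsilon>\<^sup>2 \<kappa>\<^sup>2 sin\<^sup>2 (\<kappa> x)\<close>. The exponential makes \<open>F\<close> positive and \<open>Q\<close> a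
  trigonometric polynomial, whose derivatives are explicit.\<close>

lemma perturbed_metric:
  fixes n :: int and N :: nat and \<delta> :: real
  assumes "\<delta> > 0"
  obtains Q \<Phi> where "liouville_metric Q" "eigenfunction Q 1 \<Phi>"
    "\<exists>C \<subseteq> superlevel_components \<Phi> 1. finite C \<and> int (card C) \<ge> n"
    "Cinf_close N \<delta> Q (\<lambda>_. 1)" "\<exists>k\<in>{2, 3, 4}. is_kth_eigenvalue Q k 1"
proof -
  \<comment> \<open>The successor keeps \<open>k\<close> positive when \<open>n \<le> 0\<close>.\<close>
  define k where "k = Suc (nat n)"
  define \<kappa> where "\<kappa> = real k"
  \<comment> \<open>\<open>K\<close> dominates every amplitude in the derivatives of \<open>(Q - 1) / \<epsilon>\<close> up to order \<open>N\<close>.\<close>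
  define K where "K = (2 * \<kappa>) ^ (N + 2)"
  define \<epsilon> where "\<epsilon> = min 1 \<delta> / (4 * K)"
  define F where "F x = exp (\<epsilon> * cos (\<kappa> * x))" for x
  define F' where "F' x = - (\<epsilon> * \<kappa>) * sin (\<kappa> * x) * F x" for x
  \<comment> \<open>Here \<open>sin\<^sup>2\<close> is written through the doubled frequency, so that \<open>Q\<close> is a combination of two cosines and a constant.\<close>
  define Q where "Q x = \<epsilon> * \<kappa>\<^sup>2 * cos (\<kappa> * x) + \<epsilon>\<^sup>2 * \<kappa>\<^sup>2 / 2 * cos (2 * \<kappa> * x) + (1 - \<epsilon>\<^sup>2 * \<kappa>\<^sup>2 / 2)" for x
  have \<kappa>: "\<kappa> \<ge> 1" by (simp add: \<kappa>_def k_def)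
  have K: "(2 * \<kappa>) ^ (j + 2) \<le> K" if "j \<le> N" for j
    unfolding K_def using \<kappa> that by (intro power_increasing) auto
  have K2: "4 * \<kappa>\<^sup>2 \<le> K" using K[of 0] by (simp add: power2_eq_square)
  have "\<kappa>\<^sup>2 \<ge> 1" using \<kappa> by (simp add: one_le_power)
  then have K4: "K \<ge> 4" using K2 by linarith
  have \<epsilon>0: "\<epsilon> > 0" using assms K4 by (simp add: \<epsilon>_def)
  have \<epsilon>K: "\<epsilon> * K \<le> 1 / 4" "\<epsilon> * K \<le> \<delta> / 4"
    using K4 by (simp_all add: \<epsilon>_def min_def field_simps)
  have "\<epsilon> * 4 \<le> \<epsilon> * K" using \<epsilon>0 K4 by simp
  then have \<epsilon>1: "\<epsilon> \<le> 1" using \<epsilon>K by linarith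
  have A0: "0 \<le> \<epsilon> * \<kappa>\<^sup>2" "0 \<le> \<epsilon>\<^sup>2 * \<kappa>\<^sup>2 / 2" using \<epsilon>0 by simp_all
  have "\<epsilon>\<^sup>2 \<le> \<epsilon>" using \<epsilon>0 \<epsilon>1 by (simp add: power2_eq_square mult_left_le)
  have small: "\<epsilon>\<^sup>2 * \<kappa>\<^sup>2 \<le> \<epsilon> * \<kappa>\<^sup>2"
    by (rule mult_right_mono) (use \<open>\<epsilon>\<^sup>2 \<le> \<epsilon>\<close> in auto)
  have term_le: "\<epsilon> * \<kappa>\<^sup>2 * (2 * \<kappa>) ^ j \<le> \<epsilon> * K" if "j \<le> N" for j
  proof -
    have "\<kappa>\<^sup>2 * (2 * \<kappa>) ^ j \<le> (2 * \<kappa>)\<^sup>2 * (2 * \<kappa>) ^ j"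
      using \<kappa> by (intro mult_right_mono power_mono) auto
    also have "\<dots> \<le> K" using K[OF that] by (simp only: power_add mult.commute)
    finally show ?thesis using \<epsilon>0 by (simp add: mult.assoc)
  qed
  have mass: "\<epsilon> * \<kappa>\<^sup>2 \<le> 1 / 16" 
  proof -
    have "4 * (\<epsilon> * \<kappa>\<^sup>2) = \<epsilon> * (4 * \<kappa>\<^sup>2)" by simp
    also have "\<dots> \<le> \<epsilon> * K" using K2 \<epsilon>0 by (intro mult_left_mono) auto
    finally show ?thesis using \<epsilon>K by linarith
  qed
  have amp: "\<bar>a * c\<bar> \<le> a" if "0 \<le> a" "\<bar>c\<bar> \<le> 1" for a c :: real
    using that by (simp add: abs_mult mult_left_le)
  have Q1: "\<bar>Q x - 1\<bar> \<le> 1 / 8" for x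
  proof -
    define A B where "A = \<epsilon> * \<kappa>\<^sup>2" and "B = \<epsilon>\<^sup>2 * \<kappa>\<^sup>2 / 2"
    have "\<bar>A * cos (\<kappa> * x)\<bar> \<le> A" "\<bar>B * cos (2 * \<kappa> * x)\<bar> \<le> B"
      unfolding A_def B_def by (intro amp A0 abs_cos_le_one)+
    moreover have "2 * B \<le> A" "A \<le> 1 / 16"
      using mass small by (simp_all add: A_def B_def)
    moreover have "Q x - 1 = A * cos (\<kappa> * x) + (B * cos (2 * \<kappa> * x) - B)"
      by (simp add: Q_def A_def B_def)
    ultimately show ?thesis by arith
  qed
  have cos_per: "cos (\<kappa> * (x + 2 * pi)) = cos (\<kappa> * x)" "cos (2 * \<kappa> * (x + 2 * pi)) = cos (2 * \<kappa> * x)" for x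
  proof -
    have *: "cos (t + 2 * real m * pi) = cos t" for t m
      by (simp add: cos_add cos_2npi sin_2npi del: mult_2)
    have "\<kappa> * (x + 2 * pi) = \<kappa> * x + 2 * real k * pi"
      "2 * \<kappa> * (x + 2 * pi) = 2 * \<kappa> * x + 2 * real (2 * k) * pi"
      by (simp_all add: \<kappa>_def algebra_simps)
    then show "cos (\<kappa> * (x + 2 * pi)) = cos (\<kappa> * x)" "cos (2 * \<kappa> * (x + 2 * pi)) = cos (2 * \<kappa> * x)"
      by (simp_all only: *)
  qed
  have Q_cos2: "(1 - Q x) = - (\<epsilon> * \<kappa>\<^sup>2 * cos (\<kappa> * x)) + \<epsilon>\<^sup>2 * \<kappa>\<^sup>2 * (sin (\<kappa> * x))\<^sup>2" for x
  proof -
    have *: "cos (2 * \<kappa> * x) = 1 - 2 * (sin (\<kappa> * x))\<^sup>2"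
      using cos_double_sin[of "\<kappa> * x"] by (simp add: mult.assoc)
    show ?thesis unfolding Q_def * by (simp add: field_simps)
  qed
  have dF: "(F has_field_derivative F' x) (at x)" for x
  proof -
    have "((\<lambda>x. exp (\<epsilon> * cos (\<kappa> * x))) has_field_derivative exp (\<epsilon> * cos (\<kappa> * x)) * (\<epsilon> * (- sin (\<kappa> * x) * \<kappa>))) (at x)"
      by (auto intro!: derivative_eq_intros)
    moreover have "(\<lambda>x. exp (\<epsilon> * cos (\<kappa> * x))) = F" by (simp add: F_def fun_eq_iff)
    moreover have "exp (\<epsilon> * cos (\<kappa> * x)) * (\<epsilon> * (- sin (\<kappa> * x) * \<kappa>)) = F' x"
      unfolding F'_def F_def by simp
    ultimately show ?thesis by (simp only:)
  qed
  have dF': "(F' has_field_derivative (1 - Q x) * F x) (at x)" for x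
  proof -
    have "((\<lambda>x. - (\<epsilon> * \<kappa>) * sin (\<kappa> * x)) has_field_derivative - (\<epsilon> * \<kappa>) * (\<kappa> * cos (\<kappa> * x))) (at x)"
      by (auto intro!: derivative_eq_intros)
    from DERIV_mult[OF this dF]
    have "((\<lambda>x. - (\<epsilon> * \<kappa>) * sin (\<kappa> * x) * F x) has_field_derivative
        - (\<epsilon> * \<kappa>) * (\<kappa> * cos (\<kappa> * x)) * F x + F' x * (- (\<epsilon> * \<kappa>) * sin (\<kappa> * x))) (at x)" .
    moreover have "(\<lambda>x. - (\<epsilon> * \<kappa>) * sin (\<kappa> * x) * F x) = F'" by (simp add: F'_def fun_eq_iff)
    moreover have "- (\<epsilon> * \<kappa>) * (\<kappa> * cos (\<kappa> * x)) * F x + F' x * (- (\<epsilon> * \<kappa>) * sin (\<kappa> * x)) = (1 - Q x) * F x"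
      unfolding Q_cos2 F'_def by (simp add: algebra_simps power2_eq_square)
    ultimately show ?thesis by (simp only:)
  qed
  interpret liouville_ground_state Q F F'
  proof
    show "0 < Q x" "Q x \<le> 19 / 10" for x using Q1[of x] by linarith+
    show "continuous_on UNIV Q" unfolding Q_def by (intro continuous_intros)
    show "Q (x + 2 * pi) = Q x" for x unfolding Q_def cos_per ..
    show "0 < F x" for x by (simp add: F_def)
    show "F (x + 2 * pi) = F x" for x unfolding F_def cos_per ..
    show "(F has_real_derivative F' x) (at x)" for x by (rule dF)
    show "(F' has_real_derivative (1 - Q x) * F x) (at x)" for x by (rule dF')
  qed
  have metric: "liouville_metric Q"
    using real_analytic_two_cosines Q_pos Q_per unfolding liouville_metric_def Q_def[abs_def] by blast
  have sm_cos: "C_k m (\<lambda>(x, y). F x * cos y)" and sm_sin: "C_k m (\<lambda>(x, y). F x * sin y)" for m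
    using trig_exp_C_k[OF trig_exp.mult[OF trig_exp.exp_cos trig_exp.cos_y, of \<epsilon> \<kappa>]]
      trig_exp_C_k[OF trig_exp.mult[OF trig_exp.exp_cos trig_exp.sin_y, of \<epsilon> \<kappa>]]
    by (simp_all add: F_def case_prod_beta')
  have E1_cos: "(\<lambda>(x, y). F x * cos y) \<in> eigenspace Q 1"
    by (rule product_mem_eigenspace_1[OF sm_cos F_per _ dF dF', where u' = "\<lambda>y. - sin y"])
      (auto intro!: derivative_eq_intros Q_pos)
  have E1_sin: "(\<lambda>(x, y). F x * sin y) \<in> eigenspace Q 1"
    by (rule product_mem_eigenspace_1[OF sm_sin F_per _ dF dF', where u' = cos])
      (auto intro!: derivative_eq_intros Q_pos)
  have ef: "eigenfunction Q 1 (\<lambda>(x, y). F x * cos y)"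
    unfolding eigenfunction_def using E1_cos F_pos[of 0] by (auto intro!: exI[of _ "0 :: real"])
  have comps: "\<exists>C \<subseteq> superlevel_components (\<lambda>(x, y). F x * cos y) 1. finite C \<and> int (card C) \<ge> n"
  proof -
    have "\<exists>C \<subseteq> superlevel_components (\<lambda>(x, y). F x * cos y) 1. finite C \<and> card C = k"
    proof (rule superlevel_components_product)
      show "1 \<le> k" by (simp add: k_def)
      show "0 < F x" for x by (simp add: F_def)
      show "1 < F x \<longleftrightarrow> 0 < cos (real k * x)" for x
        unfolding F_def \<kappa>_def by (rule exp_cos_gt_1_iff[OF \<epsilon>0])
    qed
    moreover have "int k \<ge> n" by (simp add: k_def)
    ultimately show ?thesis by auto
  qed
  have close: "Cinf_close N \<delta> Q (\<lambda>_. 1)"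
    unfolding Cinf_close_def
  proof (intro allI impI)
    fix j x assume j: "j \<le> N"
    have one: "(deriv ^^ j) (\<lambda>_. 1) x = (if j = 0 then 1 else (0::real))"
      using higher_deriv_two_cosines[of j 0 1 0 1 1] by simp
    have "\<bar>(deriv ^^ j) Q x - (deriv ^^ j) (\<lambda>_. 1) x\<bar> =
        \<bar>\<epsilon> * \<kappa>\<^sup>2 * \<kappa> ^ j * cos (\<kappa> * x + real j * (pi / 2))
        + \<epsilon>\<^sup>2 * \<kappa>\<^sup>2 / 2 * (2 * \<kappa>) ^ j * cos (2 * \<kappa> * x + real j * (pi / 2))
        + (if j = 0 then - (\<epsilon>\<^sup>2 * \<kappa>\<^sup>2 / 2) else 0)\<bar>"
      unfolding one Q_def[abs_def] higher_deriv_two_cosines by (simp add: add_diff_eq)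
    also have "\<dots> \<le> \<epsilon> * \<kappa>\<^sup>2 * \<kappa> ^ j + \<epsilon>\<^sup>2 * \<kappa>\<^sup>2 / 2 * (2 * \<kappa>) ^ j + \<epsilon>\<^sup>2 * \<kappa>\<^sup>2 / 2"
    proof (intro order_trans[OF abs_triangle_ineq] add_mono amp abs_cos_le_one)
      show "0 \<le> \<epsilon> * \<kappa>\<^sup>2 * \<kappa> ^ j"
        by (intro mult_nonneg_nonneg zero_le_power) (use \<epsilon>0 \<kappa> in auto)
      show "0 \<le> \<epsilon>\<^sup>2 * \<kappa>\<^sup>2 / 2 * (2 * \<kappa>) ^ j"
        using A0(2) \<kappa> by (intro mult_nonneg_nonneg[OF A0(2)] zero_le_power) auto
      show "\<bar>if j = 0 then - (\<epsilon>\<^sup>2 * \<kappa>\<^sup>2 / 2) else 0\<bar> \<le> \<epsilon>\<^sup>2 * \<kappa>\<^sup>2 / 2"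
        using A0(2) by simp
    qed
    also have "\<dots> \<le> \<epsilon> * K + \<epsilon> * K + \<epsilon> * K"
    proof (intro add_mono)
      have "\<epsilon> * \<kappa>\<^sup>2 * \<kappa> ^ j \<le> \<epsilon> * \<kappa>\<^sup>2 * (2 * \<kappa>) ^ j"
        using \<kappa> A0(1) by (intro mult_left_mono power_mono) auto
      then show "\<epsilon> * \<kappa>\<^sup>2 * \<kappa> ^ j \<le> \<epsilon> * K" using term_le[OF j] by linarith
      have "\<epsilon>\<^sup>2 * \<kappa>\<^sup>2 / 2 * (2 * \<kappa>) ^ j \<le> \<epsilon> * \<kappa>\<^sup>2 * (2 * \<kappa>) ^ j"
      proof (rule mult_right_mono)
        show "\<epsilon>\<^sup>2 * \<kappa>\<^sup>2 / 2 \<le> \<epsilon> * \<kappa>\<^sup>2" using small A0 by linarith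
      qed (use \<kappa> in simp)
      then show "\<epsilon>\<^sup>2 * \<kappa>\<^sup>2 / 2 * (2 * \<kappa>) ^ j \<le> \<epsilon> * K" using term_le[OF j] by linarith
      show "\<epsilon>\<^sup>2 * \<kappa>\<^sup>2 / 2 \<le> \<epsilon> * K" using small term_le[of 0] A0 by (simp only: power_0 mult_1_right) linarith
    qed
    also have "\<dots> < \<delta>" using \<epsilon>K assms by linarith
    finally show "\<bar>(deriv ^^ j) Q x - (deriv ^^ j) (\<lambda>_. 1) x\<bar> < \<delta>" .
  qed
  show thesis
    by (rule that[OF metric ef comps close
          index_of_eigenvalue_1[OF E1_cos E1_sin const_mem_eigenspace_0]])
qed

theorem proposition4p4:
  fixes n :: int
  shows "(\<exists>Q \<Phi>. liouville_metric Q \<and> eigenfunction Q 1 \<Phi> \<and>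
            (\<exists>F \<subseteq> superlevel_components \<Phi> 1. finite F \<and> int (card F) \<ge> n))
       \<and> (\<forall>N. \<forall>\<epsilon>>0. \<exists>Q \<Phi>. liouville_metric Q \<and> eigenfunction Q 1 \<Phi> \<and>
            (\<exists>F \<subseteq> superlevel_components \<Phi> 1. finite F \<and> int (card F) \<ge> n) \<and>
            Cinf_close N \<epsilon> Q (\<lambda>_. 1) \<and>
            (n \<ge> 4 \<longrightarrow> (\<exists>k\<in>{2, 3, 4}. is_kth_eigenvalue Q k 1)))"
proof
  show "\<exists>Q \<Phi>. liouville_metric Q \<and> eigenfunction Q 1 \<Phi> \<and>
            (\<exists>F \<subseteq> superlevel_components \<Phi> 1. finite F \<and> int (card F) \<ge> n)"
    proof -
    obtain Q \<Phi> where
      "liouville_metric Q" "eigenfunction Q 1 \<Phi>"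
      "\<exists>C \<subseteq> superlevel_components \<Phi> 1. finite C \<and> int (card C) \<ge> n"
      by (rule perturbed_metric[OF zero_less_one])
    then show ?thesis by (intro exI[of _ Q] exI[of _ \<Phi>] conjI)
  qed
  show "\<forall>N. \<forall>\<epsilon>>0. \<exists>Q \<Phi>. liouville_metric Q \<and> eigenfunction Q 1 \<Phi> \<and>
            (\<exists>F \<subseteq> superlevel_components \<Phi> 1. finite F \<and> int (card F) \<ge> n) \<and>
            Cinf_close N \<epsilon> Q (\<lambda>_. 1) \<and>
            (n \<ge> 4 \<longrightarrow> (\<exists>k\<in>{2, 3, 4}. is_kth_eigenvalue Q k 1))"
  proof (intro allI impI)
    fix N and \<epsilon> :: real assume "\<epsilon> > 0"
    then obtain Q \<Phi> where
      "liouville_metric Q" "eigenfunction Q 1 \<Phi>"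
      "\<exists>C \<subseteq> superlevel_components \<Phi> 1. finite C \<and> int (card C) \<ge> n"
      "Cinf_close N \<epsilon> Q (\<lambda>_. 1)" "\<exists>k\<in>{2, 3, 4}. is_kth_eigenvalue Q k 1"
      by (rule perturbed_metric)
    then show "\<exists>Q \<Phi>. liouville_metric Q \<and> eigenfunction Q 1 \<Phi> \<and>
            (\<exists>F \<subseteq> superlevel_components \<Phi> 1. finite F \<and> int (card F) \<ge> n) \<and>
            Cinf_close N \<epsilon> Q (\<lambda>_. 1) \<and>
            (n \<ge> 4 \<longrightarrow> (\<exists>k\<in>{2, 3, 4}. is_kth_eigenvalue Q k 1))"
      by (intro exI[of _ Q] exI[of _ \<Phi>] conjI impI)
  qed
qed

end
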